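(* There exists a constant $C > 0$ such that, as $n \to \infty$, $D_n = (1 + O(n^{-1}))\, D_n^\star = \frac{C}{\sqrt{n}}\, e^{n-1}\,\mathrm{sf}(n-1)\,(1 + O(n^{-1}))$, where $\mathrm{sf}(k) = \prod_{i=0}^{k} i!$.
   Context: A directed ordered acyclic graph (DOAG) is a tuple $(V, E, (\prec_v)_{v \in V \cup \{\emptyset\}})$ where $V$ is a finite set of vertices, $E \subseteq V \times V$ is a set of edges such that $(V,E)$ is acyclic, for each $v \in V$, $\prec_v$ is a total order on the outgoing edges of $v$, and $\prec_\emptyset$ is a total order on the sources (vertices with no incoming edge). Two DOAGs are equal if there is a bijection of vertex sets preserving edges and all orders. $D_n$ is the number of DOAGs with $n$ vertices (any number of edges and sources), and $D_n^\star$ is the number of DOAGs with $n$ vertices and exactly one source. *)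

theory Defs
  imports Complex_Main "HOL-Library.Landau_Symbols"
begin

record 'a doag =
  verts :: "'a set"
  edges :: "('a \<times> 'a) set"
  edge_order :: "'a \<Rightarrow> (('a \<times> 'a) \<times> ('a \<times> 'a)) set"
  source_order :: "('a \<times> 'a) set"

definition out_edges :: "'a doag \<Rightarrow> 'a \<Rightarrow> ('a \<times> 'a) set" where
  "out_edges G v = {e \<in> edges G. fst e = v}"

definition sources :: "'a doag \<Rightarrow> 'a set" where
  "sources G = {v \<in> verts G. \<forall>u. (u, v) \<notin> edges G}"

text \<open>The library's \<^const>\<open>strict_linear_order_on\<close> does not confine the relation to the
  carrier; here a total order on \<open>A\<close> is a relation on \<open>A\<close> only.\<close>

definition strict_total_order :: "'b set \<Rightarrow> ('b \<times> 'b) set \<Rightarrow> bool" where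
  "strict_total_order A r \<longleftrightarrow> r \<subseteq> A \<times> A \<and> strict_linear_order_on A r"

text \<open>The family of orders is indexed by the vertices; the total function \<^const>\<open>edge_order\<close>
  takes the dummy value \<open>{}\<close> elsewhere.\<close>

definition is_doag :: "'a doag \<Rightarrow> bool" where
  "is_doag G \<longleftrightarrow>
     finite (verts G) \<and> edges G \<subseteq> verts G \<times> verts G \<and> acyclic (edges G) \<and>
     (\<forall>v \<in> verts G. strict_total_order (out_edges G v) (edge_order G v)) \<and>
     (\<forall>v. v \<notin> verts G \<longrightarrow> edge_order G v = {}) \<and>
     strict_total_order (sources G) (source_order G)"

definition doag_isomorphism :: "('a \<Rightarrow> 'b) \<Rightarrow> 'a doag \<Rightarrow> 'b doag \<Rightarrow> bool" where
  "doag_isomorphism f G H \<longleftrightarrow>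
     bij_betw f (verts G) (verts H) \<and>
     edges H = map_prod f f ` edges G \<and>
     (\<forall>v \<in> verts G.
        edge_order H (f v) = map_prod (map_prod f f) (map_prod f f) ` edge_order G v) \<and>
     source_order H = map_prod f f ` source_order G"

definition doag_iso :: "('a doag \<times> 'a doag) set" where
  "doag_iso = {(G, H). is_doag G \<and> is_doag H \<and> (\<exists>f. doag_isomorphism f G H)}"

text \<open>DOAGs are counted up to isomorphism. Every finite vertex set is in bijection with a set of
  natural numbers, so vertices in \<^typ>\<open>nat\<close> represent all isomorphism classes.\<close>

definition D :: "nat \<Rightarrow> nat" where
  "D n = card ({G :: nat doag. is_doag G \<and> card (verts G) = n} // doag_iso)"

definition D_star :: "nat \<Rightarrow> nat" where
  "D_star n =
     card ({G :: nat doag. is_doag G \<and> card (verts G) = n \<and> card (sources G) = 1} // doag_iso)"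

definition sf :: "nat \<Rightarrow> nat" where
  "sf k = (\<Prod>i = 0..k. fact i)"

text \<open>The quotients above are by an equivalence relation and are finite, so that \<^const>\<open>card\<close>
  does count isomorphism classes.\<close>

lemma is_doag_edge_order_subset:
  assumes "is_doag G" shows "edge_order G v \<subseteq> edges G \<times> edges G"
proof (cases "v \<in> verts G")
  case True
  then show ?thesis
    using assms unfolding is_doag_def strict_total_order_def out_edges_def by blast
next
  case False
  then show ?thesis using assms unfolding is_doag_def by simp
qed

lemma is_doag_source_order_subset:
  assumes "is_doag G" shows "source_order G \<subseteq> verts G \<times> verts G"
  using assms unfolding is_doag_def strict_total_order_def sources_def by blast

lemma map_prod_image_inverse:
  assumes "r \<subseteq> A \<times> A" "\<And>x. x \<in> A \<Longrightarrow> g (f x) = x"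
  shows "map_prod g g ` map_prod f f ` r = r"
proof -
  have "\<And>p. p \<in> r \<Longrightarrow> map_prod g g (map_prod f f p) = p"
    using assms by (auto simp: map_prod_def split: prod.splits)
  then show ?thesis by (simp add: image_image)
qed

lemma doag_isomorphism_sym:
  assumes "is_doag G" "doag_isomorphism f G H"
  shows "doag_isomorphism (inv_into (verts G) f) H G"
proof -
  let ?g = "inv_into (verts G) f"
  have bij: "bij_betw f (verts G) (verts H)"
    using assms(2) unfolding doag_isomorphism_def by blast
  have inv: "\<And>x. x \<in> verts G \<Longrightarrow> ?g (f x) = x"
    using bij by (simp add: bij_betw_inv_into_left)
  have EG: "edges G \<subseteq> verts G \<times> verts G"
    using assms(1) unfolding is_doag_def by blast
  have invE: "\<And>e. e \<in> edges G \<Longrightarrow> map_prod ?g ?g (map_prod f f e) = e"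
    using EG inv by auto
  have o: "edge_order G (?g w) = map_prod (map_prod ?g ?g) (map_prod ?g ?g) ` edge_order H w"
    if w: "w \<in> verts H" for w
  proof -
    have v: "?g w \<in> verts G" "f (?g w) = w"
      using bij w bij_betw_inv_into_right[OF bij w] bij_betw_apply[OF bij_betw_inv_into[OF bij] w]
      by auto
    have "edge_order H w =
        map_prod (map_prod f f) (map_prod f f) ` edge_order G (?g w)"
      using assms(2) v unfolding doag_isomorphism_def by metis
    then show ?thesis
      using map_prod_image_inverse[where f = "map_prod f f" and g = "map_prod ?g ?g",
          OF is_doag_edge_order_subset[OF assms(1)] invE]
      by simp
  qed
  show ?thesis
    unfolding doag_isomorphism_def
  proof (intro conjI ballI)
    show "bij_betw ?g (verts H) (verts G)" by (rule bij_betw_inv_into[OF bij])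
    show "edges G = map_prod ?g ?g ` edges H"
      using assms(2) map_prod_image_inverse[where f = f and g = ?g, OF EG inv] unfolding doag_isomorphism_def by simp
    show "source_order G = map_prod ?g ?g ` source_order H"
      using assms(2) map_prod_image_inverse[where f = f and g = ?g,
          OF is_doag_source_order_subset[OF assms(1)] inv]
      unfolding doag_isomorphism_def by simp
  qed (rule o)
qed

lemma doag_isomorphism_trans:
  assumes "doag_isomorphism f G H" "doag_isomorphism g H K"
  shows "doag_isomorphism (g \<circ> f) G K"
proof -
  have mp: "map_prod (g \<circ> f) (g \<circ> f) ` X = map_prod g g ` map_prod f f ` X" for X
    by (simp add: image_image o_def split_def map_prod_def)
  have mp2: "map_prod (map_prod (g \<circ> f) (g \<circ> f)) (map_prod (g \<circ> f) (g \<circ> f)) ` X =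
      map_prod (map_prod g g) (map_prod g g) ` map_prod (map_prod f f) (map_prod f f) ` X" for X
    by (simp add: image_image o_def split_def map_prod_def)
  have f: "bij_betw f (verts G) (verts H)" and g: "bij_betw g (verts H) (verts K)"
    using assms unfolding doag_isomorphism_def by simp_all
  have fv: "f v \<in> verts H" if "v \<in> verts G" for v
    using bij_betw_apply[OF f that] .
  show ?thesis
    unfolding doag_isomorphism_def
  proof (intro conjI ballI)
    show "bij_betw (g \<circ> f) (verts G) (verts K)" by (rule bij_betw_trans[OF f g])
    show "edges K = map_prod (g \<circ> f) (g \<circ> f) ` edges G"
      and "source_order K = map_prod (g \<circ> f) (g \<circ> f) ` source_order G"
      using assms unfolding doag_isomorphism_def mp by simp_all
    show "edge_order K ((g \<circ> f) v) =
        map_prod (map_prod (g \<circ> f) (g \<circ> f)) (map_prod (g \<circ> f) (g \<circ> f)) ` edge_order G v"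
      if "v \<in> verts G" for v
      using assms fv[OF that] that unfolding doag_isomorphism_def mp2 by simp
  qed
qed

lemma doag_isomorphism_refl: "doag_isomorphism id G G"
  unfolding doag_isomorphism_def by (simp add: map_prod.id)

lemma equiv_doag_iso: "equiv {G. is_doag G} doag_iso"
proof (rule equivI)
  show "doag_iso \<subseteq> {G. is_doag G} \<times> {G. is_doag G}"
    unfolding doag_iso_def by auto
  show "refl_on {G. is_doag G} doag_iso"
    unfolding doag_iso_def by (auto intro!: refl_onI exI[of _ id] doag_isomorphism_refl)
  show "sym doag_iso"
    unfolding doag_iso_def by (auto intro!: symI dest: doag_isomorphism_sym)
  show "trans doag_iso"
    unfolding doag_iso_def by (auto intro!: transI dest: doag_isomorphism_trans)
qed

lemma finite_doag_classes: "finite ({G :: 'a doag. is_doag G \<and> card (verts G) = n} // doag_iso)"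
proof -
  define S where "S = {G :: 'a doag. is_doag G \<and> card (verts G) = n}"
  let ?V = "{..<n}"
  let ?B = "Pow ((?V \<times> ?V) \<times> (?V \<times> ?V))"
  let ?F = "{h. \<forall>w. (w \<in> ?V \<longrightarrow> h w \<in> ?B) \<and> (w \<notin> ?V \<longrightarrow> h w = {})}"
  define P where "P = (\<lambda>(E, h, s). \<lparr>verts = ?V, edges = E, edge_order = h, source_order = s\<rparr>)
      ` (Pow (?V \<times> ?V) \<times> ?F \<times> Pow (?V \<times> ?V))"
  have "finite ?F" by (rule finite_set_of_finite_funs) simp_all
  then have finP: "finite P" unfolding P_def by simp
  have ex: "\<exists>Q f. Q \<in> P \<and> doag_isomorphism f G Q" if G: "G \<in> S" for G
  proof -
    have fin: "finite (verts G)" and E: "edges G \<subseteq> verts G \<times> verts G"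
      and so: "source_order G \<subseteq> verts G \<times> verts G"
      using G is_doag_source_order_subset[of G] unfolding S_def is_doag_def by simp_all
    have eo: "edge_order G v \<subseteq> edges G \<times> edges G" for v
      using G is_doag_edge_order_subset[of G v] unfolding S_def by simp
    obtain f where f: "bij_betw f (verts G) ?V"
      using ex_bij_betw_finite_nat[OF fin] G unfolding S_def by (auto simp: atLeast0LessThan)
    have fv: "f v < n" if "v \<in> verts G" for v
      using bij_betw_apply[OF f that] by simp
    define h where "h w = (if w < n then
        map_prod (map_prod f f) (map_prod f f) ` edge_order G (inv_into (verts G) f w) else {})" for w
    have im: "map_prod f f ` X \<subseteq> ?V \<times> ?V" if "X \<subseteq> verts G \<times> verts G" for X
      using that fv by auto
    have "map_prod (map_prod f f) (map_prod f f) ` edge_order G v \<in> ?B" for v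
    proof -
      have "map_prod (map_prod f f) (map_prod f f) ` edge_order G v
          \<subseteq> (map_prod f f ` edges G) \<times> (map_prod f f ` edges G)"
        using eo[of v] by auto
      also have "\<dots> \<subseteq> (?V \<times> ?V) \<times> (?V \<times> ?V)"
        by (rule Sigma_mono) (rule im[OF E])+
      finally show ?thesis by (rule PowI)
    qed
    then have h: "h \<in> ?F" unfolding h_def by simp
    let ?Q = "\<lparr>verts = ?V, edges = map_prod f f ` edges G, edge_order = h,
        source_order = map_prod f f ` source_order G\<rparr>"
    have "?Q \<in> P"
      unfolding P_def
      by (rule image_eqI[where x = "(map_prod f f ` edges G, h, map_prod f f ` source_order G)"])
        (use im[OF E] im[OF so] h in simp_all)
    moreover have "doag_isomorphism f G ?Q"
      unfolding doag_isomorphism_def using f fv by (simp add: h_def bij_betw_inv_into_left)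
    ultimately show ?thesis by blast
  qed
  then obtain c d where c: "\<And>G. G \<in> S \<Longrightarrow> c G \<in> P \<and> doag_isomorphism (d G) G (c G)"
    by metis
  have rel: "(G, H) \<in> doag_iso" if "G \<in> S" "H \<in> S" "c G = c H" for G H
  proof -
    have "doag_isomorphism (inv_into (verts H) (d H)) (c G) H"
      using doag_isomorphism_sym[of H "d H" "c H"] c[OF that(2)] that unfolding S_def by simp
    then show ?thesis
      using doag_isomorphism_trans[of "d G" G "c G"] c[OF that(1)] that
      unfolding doag_iso_def S_def by blast
  qed
  let ?r = "\<lambda>Q. doag_iso `` {SOME G. G \<in> S \<and> c G = Q}"
  have "S // doag_iso \<subseteq> ?r ` P"
  proof
    fix X assume "X \<in> S // doag_iso"
    then obtain G where G: "G \<in> S" "X = doag_iso `` {G}" by (rule quotientE)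
    let ?H = "SOME H. H \<in> S \<and> c H = c G"
    have "?H \<in> S \<and> c ?H = c G"
      by (rule someI[where P = "\<lambda>H. H \<in> S \<and> c H = c G"]) (use G in simp)
    then have "(G, ?H) \<in> doag_iso" using rel[OF G(1), of ?H] by metis
    then have "X = ?r (c G)" using G(2) equiv_class_eq[OF equiv_doag_iso] by simp
    then show "X \<in> ?r ` P" using c[OF G(1)] by blast
  qed
  then show ?thesis using finP unfolding S_def by (meson finite_imageI finite_subset)
qed

end

theory Submission
  imports Defs "HOL-Real_Asymp.Real_Asymp"
begin

text \<open>Deleting the least source of a graph with \<open>n + 1\<close> vertices and \<open>k + 1\<close> sources leaves a graph with
  \<open>n\<close> vertices and \<open>k + s\<close> sources, where \<open>s\<close> sources are newly exposed. The deleted vertex can be put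
  back by interleaving these \<open>s\<close> successors, whose order is forced, with an arrangement of any of the
  other \<open>n - k - s\<close> vertices; this gives at most \<open>e (n - k)!/s!\<close> choices. Hence every further source
  costs a factor \<open>n\<close>, so graphs with one source dominate, and their number \<open>A n\<close> satisfies
  \<open>A (n + 1) = e n! A n (1 - 1/(2n) + O(1/n\<^sup>2))\<close>. Taking the product yields the factor \<open>1/\<surd>n\<close>.\<close>

section \<open>Total orders as lists\<close>

text \<open>The orders make a graph rigid: repeated deletion enumerates its vertices canonically, so
  an isomorphism class is the same thing as a code, no symmetry factor appears, and the recurrence
  is an exact count of rows. The constant e arises because a row may leave out \<open>l\<close> of
  the available vertices, which weighs about 1/l! of the rows that leave out none. What shapes the
  analysis is the required precision. A constant C with relative error O(1/n) follows once
  consecutive ratios of the normalised count are 1 + O(1/n^2), so the 1/n term of the ratio must be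
  exact. Two-source graphs contribute to it: their share is 1/n and must be known up to O(1/n^2),
  whereas their weight is needed only to leading order. Ratio and share depend on each other, and
  the circle is broken by bootstrapping: a crude bound of all graphs by a multiple of the one-source
  graphs makes the share O(1/n), which gives the ratio up to O(1/n), which gives the share up to
  O(1/n^2), which gives the ratio to the same order.\<close>

primrec list_order :: "'b list \<Rightarrow> ('b \<times> 'b) set" where
  "list_order [] = {}"
| "list_order (x # xs) = {x} \<times> set xs \<union> list_order xs"

lemma list_order_subset: "list_order xs \<subseteq> set xs \<times> set xs"
  by (induction xs) auto

lemma list_order_map: "list_order (map f xs) = map_prod f f ` list_order xs"
  by (induction xs) (auto simp: image_Un image_iff)

lemma strict_total_order_list_order:
  assumes "distinct xs" shows "strict_total_order (set xs) (list_order xs)"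
  using assms
proof (induction xs)
  case Nil
  then show ?case by (simp add: strict_total_order_def strict_linear_order_on_def irrefl_def)
next
  case (Cons x xs)
  have sub: "list_order xs \<subseteq> set xs \<times> set xs" by (rule list_order_subset)
  have IH: "trans (list_order xs)" "irrefl (list_order xs)" "total_on (set xs) (list_order xs)"
    using Cons by (auto simp: strict_total_order_def strict_linear_order_on_def)
  have "trans (list_order (x # xs))"
    using IH(1) sub Cons.prems unfolding trans_def by auto
  moreover have "irrefl (list_order (x # xs))"
    using IH(2) Cons.prems by (auto simp: irrefl_def)
  moreover have "total_on (set (x # xs)) (list_order (x # xs))"
    using IH(3) by (auto simp: total_on_def)
  ultimately show ?case
    using list_order_subset[of "x # xs"]
    unfolding strict_total_order_def strict_linear_order_on_def by blast
qed

text \<open>The head is the least element, and restricting the order to the remaining elements gives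
  the order of the tail. Equality of the sets must be assumed, because \<open>[]\<close> and all
  singleton lists have the same empty order.\<close>

lemma list_order_inject:
  assumes "distinct xs" "distinct ys" "set xs = set ys" "list_order xs = list_order ys"
  shows "xs = ys"
  using assms
proof (induction xs arbitrary: ys)
  case Nil
  then show ?case by simp
next
  case (Cons x xs)
  obtain y ys' where ys: "ys = y # ys'" using Cons.prems(3) by (cases ys) auto
  have "x = y"
  proof (rule ccontr)
    assume "x \<noteq> y"
    then have "(x, y) \<in> list_order (x # xs)" using Cons.prems(3) ys by auto
    then have "(x, y) \<in> list_order (y # ys')" unfolding Cons.prems(4) ys .
    then have "(x, y) \<in> list_order ys'" using \<open>x \<noteq> y\<close> by simp
    then show False using Cons.prems(2) ys list_order_subset[of ys'] by auto
  qed
  have sets: "set xs = set ys'" using Cons.prems(1-3) ys \<open>x = y\<close> by auto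
  moreover have "list_order xs = list_order (x # xs) \<inter> (set xs \<times> set xs)"
    using Cons.prems(1) list_order_subset[of xs] by auto
  moreover have "list_order ys' = list_order (y # ys') \<inter> (set ys' \<times> set ys')"
    using Cons.prems(2) ys list_order_subset[of ys'] by auto
  ultimately have "list_order xs = list_order ys'"
    using Cons.prems(4) ys by simp
  then show ?case using Cons.IH[of ys'] Cons.prems(1,2) ys \<open>x = y\<close> sets by simp
qed

text \<open>Finiteness and acyclicity make the relation well founded; a minimal element is least by
  totality and becomes the head.\<close>

lemma strict_total_order_obtain_list:
  assumes "finite A" "strict_total_order A r"
  shows "\<exists>xs. distinct xs \<and> set xs = A \<and> r = list_order xs"
  using assms
proof (induction "card A" arbitrary: A r)
  case 0
  then show ?case by (auto simp: strict_total_order_def)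
next
  case (Suc n)
  have r: "r \<subseteq> A \<times> A" "trans r" "irrefl r" "total_on A r"
    using Suc.prems by (auto simp: strict_total_order_def strict_linear_order_on_def)
  have "finite r" using r(1) Suc.prems(1) finite_subset by blast
  moreover have "acyclic r" using r(2,3) by (simp add: acyclic_irrefl)
  ultimately have "wf r" by (rule finite_acyclic_wf)
  moreover have "A \<noteq> {}" using Suc.hyps by auto
  ultimately obtain x where x: "x \<in> A" "\<And>y. (y, x) \<in> r \<Longrightarrow> y \<notin> A"
    by (meson ex_in_conv wfE_min)
  let ?A = "A - {x}"
  have "strict_total_order ?A (r \<inter> ?A \<times> ?A)"
    using r unfolding strict_total_order_def strict_linear_order_on_def
    by (auto simp: trans_def irrefl_def total_on_def)
  moreover have "n = card ?A" using Suc.hyps(2) Suc.prems(1) x(1) by simp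
  ultimately obtain xs where xs: "distinct xs" "set xs = ?A" "r \<inter> ?A \<times> ?A = list_order xs"
    using Suc.hyps(1)[of ?A] Suc.prems(1) by blast
  have "(x, a) \<in> r" if "a \<in> ?A" for a
    using that x r(1,4) unfolding total_on_def by blast
  then have "r = list_order (x # xs)"
    using r(1,3) x xs by (auto simp flip: xs(3) simp: irrefl_def)
  then show ?case using xs x(1) by (intro exI[of _ "x # xs"]) auto
qed

section \<open>Graphs described by successor lists\<close>

text \<open>Edge orders compare edges, but all edges out of \<open>v\<close> share their first
  component, so the list \<open>out v\<close> of targets carries the same information.\<close>

definition doag_lists :: "'a doag \<Rightarrow> ('a \<Rightarrow> 'a list) \<Rightarrow> 'a list \<Rightarrow> bool" where
  "doag_lists G out ss \<longleftrightarrow>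
     finite (verts G) \<and> edges G = {(v, w). v \<in> verts G \<and> w \<in> set (out v)} \<and>
     (\<forall>v \<in> verts G. set (out v) \<subseteq> verts G \<and> distinct (out v) \<and>
        edge_order G v = list_order (map (Pair v) (out v))) \<and>
     (\<forall>v. v \<notin> verts G \<longrightarrow> edge_order G v = {}) \<and>
     acyclic (edges G) \<and>
     distinct ss \<and> set ss = sources G \<and> source_order G = list_order ss"

lemma doag_lists_imp_is_doag:
  assumes "doag_lists G out ss"
  shows "is_doag G"
proof -
  have "strict_total_order (out_edges G v) (edge_order G v)" if "v \<in> verts G" for v
  proof -
    have "out_edges G v = set (map (Pair v) (out v))"
      using assms that unfolding doag_lists_def out_edges_def by auto
    moreover have "distinct (map (Pair v) (out v))"
      using assms that unfolding doag_lists_def by (auto simp: distinct_map inj_on_def)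
    ultimately show ?thesis
      using assms that strict_total_order_list_order[of "map (Pair v) (out v)"]
      unfolding doag_lists_def by simp
  qed
  moreover have "strict_total_order (sources G) (source_order G)"
    using assms strict_total_order_list_order[of ss] unfolding doag_lists_def by simp
  ultimately show ?thesis
    using assms unfolding doag_lists_def is_doag_def by auto
qed

lemma is_doag_obtain_lists:
  assumes "is_doag G"
  obtains out ss where "doag_lists G out ss"
proof -
  have fin: "finite (verts G)" and E: "edges G \<subseteq> verts G \<times> verts G"
    using assms unfolding is_doag_def by auto
  have finE: "finite (edges G)" using fin E finite_subset by blast
  have "\<exists>xs. distinct xs \<and> set xs = {w. (v, w) \<in> edges G} \<and>
      edge_order G v = list_order (map (Pair v) xs)" if "v \<in> verts G" for v
  proof -
    have "finite (out_edges G v)" using finE by (simp add: out_edges_def)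
    moreover have "strict_total_order (out_edges G v) (edge_order G v)"
      using assms that unfolding is_doag_def by blast
    ultimately obtain es where es: "distinct es" "set es = out_edges G v"
        "edge_order G v = list_order es"
      using strict_total_order_obtain_list by blast
    have "map (Pair v) (map snd es) = es"
      using es(2) by (auto simp: out_edges_def intro!: map_idI)
    moreover have "distinct (map snd es)"
      using es(1,2) by (auto simp: distinct_map inj_on_def out_edges_def)
    moreover have "set (map snd es) = {w. (v, w) \<in> edges G}"
      using es(2) by (force simp: out_edges_def)
    ultimately show ?thesis using es(3) by metis
  qed
  then obtain out where out: "\<And>v. v \<in> verts G \<Longrightarrow> distinct (out v) \<and>
      set (out v) = {w. (v, w) \<in> edges G} \<and> edge_order G v = list_order (map (Pair v) (out v))"
    by metis
  have "finite (sources G)" using fin by (simp add: sources_def)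
  then obtain ss where "distinct ss" "set ss = sources G" "source_order G = list_order ss"
    using assms strict_total_order_obtain_list unfolding is_doag_def by metis
  then have "doag_lists G out ss"
    using assms out E unfolding doag_lists_def is_doag_def by auto
  then show ?thesis by (rule that)
qed

text \<open>Pushing an order forward along \<open>f\<close> maps its list, and a list without
  repetitions is determined by its set and its order. Isomorphisms can therefore be treated as maps
  of lists.\<close>

lemma doag_isomorphism_lists:
  assumes G: "doag_lists G out ss" and H: "doag_lists H out' ss'"
    and f: "doag_isomorphism f G H"
  shows "\<And>v. v \<in> verts G \<Longrightarrow> out' (f v) = map f (out v)" and "ss' = map f ss"
proof -
  have bij: "bij_betw f (verts G) (verts H)" and E: "edges H = map_prod f f ` edges G"
    using f unfolding doag_isomorphism_def by auto
  have inj: "inj_on f (verts G)" using bij by (rule bij_betw_imp_inj_on)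
  have fv: "f v \<in> verts H" if "v \<in> verts G" for v using bij_betw_apply[OF bij that] .
  show "out' (f v) = map f (out v)" if v: "v \<in> verts G" for v
  proof -
    have "list_order (map (Pair (f v)) (out' (f v))) = edge_order H (f v)"
      using H fv[OF v] unfolding doag_lists_def by simp
    also have "\<dots> = map_prod (map_prod f f) (map_prod f f) ` list_order (map (Pair v) (out v))"
      using f G v unfolding doag_isomorphism_def doag_lists_def by simp
    also have "\<dots> = list_order (map (Pair (f v)) (map f (out v)))"
      by (simp flip: list_order_map add: o_def)
    finally have ord: "list_order (map (Pair (f v)) (out' (f v))) =
        list_order (map (Pair (f v)) (map f (out v)))" .
    have "set (out' (f v)) = {w. (f v, w) \<in> edges H}"
      using H fv[OF v] unfolding doag_lists_def by auto
    also have "\<dots> = f ` {w. (v, w) \<in> edges G}"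
    proof -
      have "edges G \<subseteq> verts G \<times> verts G" using G unfolding doag_lists_def by auto
      then show ?thesis unfolding E using inj v by (auto simp: inj_on_def)
    qed
    also have "\<dots> = set (map f (out v))"
      using G v unfolding doag_lists_def by auto
    finally have set: "set (out' (f v)) = set (map f (out v))" .
    have "distinct (map f (out v))"
      using G v inj unfolding doag_lists_def by (auto simp: distinct_map intro: inj_on_subset)
    moreover have "distinct (out' (f v))"
      using H fv[OF v] unfolding doag_lists_def by auto
    ultimately have "map (Pair (f v)) (out' (f v)) = map (Pair (f v)) (map f (out v))"
      using ord set
      by (intro list_order_inject) (auto simp: distinct_map inj_on_def)
    then show ?thesis by (subst (asm) inj_map_eq_map) (auto simp: inj_def)
  qed
  have src: "set ss \<subseteq> verts G"
    using G unfolding doag_lists_def sources_def by auto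
  have "f ` sources G = sources H"
  proof -
    have "(u, f v) \<in> edges H \<longleftrightarrow> (\<exists>u'. u = f u' \<and> (u', v) \<in> edges G)" if "v \<in> verts G" for u v
    proof -
      have "edges G \<subseteq> verts G \<times> verts G" using G unfolding doag_lists_def by auto
      then show ?thesis unfolding E using inj that by (auto simp: inj_on_def)
    qed
    moreover have "verts H = f ` verts G" using bij by (simp add: bij_betw_def)
    ultimately show ?thesis unfolding sources_def by auto
  qed
  moreover have "source_order H = map_prod f f ` source_order G"
    using f unfolding doag_isomorphism_def by auto
  moreover have "inj_on f (set ss)" using inj src by (rule inj_on_subset)
  ultimately show "ss' = map f ss"
    using G H unfolding doag_lists_def
    by (intro list_order_inject) (auto simp: distinct_map list_order_map)
qed

lemma doag_isomorphismI:
  assumes G: "doag_lists G out ss" and H: "doag_lists H out' ss'"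
    and bij: "bij_betw f (verts G) (verts H)"
    and out: "\<And>v. v \<in> verts G \<Longrightarrow> out' (f v) = map f (out v)" and ss: "ss' = map f ss"
  shows "doag_isomorphism f G H"
proof -
  have VH: "verts H = f ` verts G" using bij by (simp add: bij_betw_def)
  have EG: "edges G = {(v, w). v \<in> verts G \<and> w \<in> set (out v)}"
    and EH: "edges H = {(v, w). v \<in> verts H \<and> w \<in> set (out' v)}"
    using G H unfolding doag_lists_def by blast+
  have "edges H = map_prod f f ` edges G"
  proof (intro equalityI subsetI)
    fix p assume "p \<in> edges H"
    then obtain v w where "p = (f v, w)" "v \<in> verts G" "w \<in> f ` set (out v)"
      unfolding EH VH using out by auto
    then show "p \<in> map_prod f f ` edges G" unfolding EG by force
  next
    fix p assume "p \<in> map_prod f f ` edges G"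
    then show "p \<in> edges H" unfolding EG EH VH using out by auto
  qed
  moreover have "edge_order H (f v) = map_prod (map_prod f f) (map_prod f f) ` edge_order G v"
    if "v \<in> verts G" for v
  proof -
    have "f v \<in> verts H" using that VH by simp
    then show ?thesis
      using that G H out unfolding doag_lists_def by (simp flip: list_order_map add: o_def)
  qed
  moreover have "source_order H = map_prod f f ` source_order G"
    using G H ss unfolding doag_lists_def by (simp add: list_order_map)
  ultimately show ?thesis using bij unfolding doag_isomorphism_def by simp
qed

section \<open>Codes\<close>

text \<open>Removing the least source again and again, and appending the sources that this exposes to the
  list of sources in the order of the deleted edges, enumerates the vertices. Row \<open>i\<close> of the code of
  a graph lists the successors of the \<open>i\<close>-th vertex, each as its position among the later vertices,
  counted from \<open>0\<close>. The sources of a remainder are its first \<open>src\<close> vertices, those that have just been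
  exposed being the last of them.\<close>

primrec src :: "nat list list \<Rightarrow> nat" where
  "src [] = 0"
| "src (r # rs) = Suc (src rs - length (filter (\<lambda>j. j < src rs) r))"

text \<open>The filter selects the successors that are sources of the remainder, that is, those
  exposed by the deletion. They were appended to the source list in the order of the deleted edges,
  so they must be its last \<open>s\<close> entries in increasing order; the other successors may be
  interleaved freely.\<close>

primrec valid_code :: "nat list list \<Rightarrow> bool" where
  "valid_code [] \<longleftrightarrow> True"
| "valid_code (r # rs) \<longleftrightarrow> valid_code rs \<and> distinct r \<and> set r \<subseteq> {..<length rs} \<and>
     (\<exists>s \<le> src rs. filter (\<lambda>j. j < src rs) r = [src rs - s..<src rs])"

lemma src_le_length: "src rs \<le> length rs"
  by (induction rs) auto

lemma valid_drop: "valid_code rs \<Longrightarrow> valid_code (drop a rs)"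
proof (induction rs arbitrary: a)
  case (Cons r rs)
  then show ?case by (cases a) auto
qed simp

text \<open>Positions in a row are relative, so that \<open>drop a rs\<close> is itself a code,
  namely of the remainder after \<open>a\<close> deletions; the shift restores absolute vertex
  numbers.\<close>

definition succs :: "nat list list \<Rightarrow> nat \<Rightarrow> nat list" where
  "succs rs i = map (\<lambda>j. Suc (i + j)) (rs ! i)"

definition decode :: "nat list list \<Rightarrow> nat doag" where
  "decode rs = \<lparr>verts = {..<length rs},
     edges = {(i, j). i < length rs \<and> j \<in> set (succs rs i)},
     edge_order = (\<lambda>i. if i < length rs then list_order (map (Pair i) (succs rs i)) else {}),
     source_order = list_order [0..<src rs]\<rparr>"

lemma succs_props:
  assumes "valid_code rs" "i < length rs"
  shows "distinct (succs rs i)" "set (succs rs i) \<subseteq> {i<..<length rs}"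
proof -
  have "valid_code (rs ! i # drop (Suc i) rs)"
    using valid_drop[OF assms(1), of i] assms(2) by (simp add: Cons_nth_drop_Suc)
  then have "distinct (rs ! i)" "set (rs ! i) \<subseteq> {..<length rs - Suc i}" by auto
  then show "distinct (succs rs i)" "set (succs rs i) \<subseteq> {i<..<length rs}"
    unfolding succs_def by (auto simp: distinct_map inj_on_def)
qed

lemma valid_row:
  assumes "valid_code rs" "a < length rs"
  obtains s where "s \<le> src (drop (Suc a) rs)"
    "filter (\<lambda>j. j < src (drop (Suc a) rs)) (rs ! a) =
      [src (drop (Suc a) rs) - s..<src (drop (Suc a) rs)]"
    "src (drop a rs) = Suc (src (drop (Suc a) rs) - s)"
proof -
  have d: "drop a rs = rs ! a # drop (Suc a) rs"
    using assms(2) by (simp add: Cons_nth_drop_Suc)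
  have "valid_code (rs ! a # drop (Suc a) rs)"
    using valid_drop[OF assms(1), of a] d by simp
  then obtain s where "s \<le> src (drop (Suc a) rs)"
    "filter (\<lambda>j. j < src (drop (Suc a) rs)) (rs ! a) =
      [src (drop (Suc a) rs) - s..<src (drop (Suc a) rs)]"
    by auto
  then show ?thesis using that d by simp
qed

text \<open>Downward induction on \<open>a\<close>: edges only go up, so \<open>a\<close> is a
  source of the suffix, and its row takes away exactly the last \<open>s\<close> sources of the next
  suffix. The case \<open>a = 0\<close> gives the sources of the decoded graph.\<close>

lemma tail_sources:
  assumes "valid_code rs" "a \<le> length rs"
  shows "{w \<in> {a..<length rs}. \<forall>u \<in> {a..<length rs}. w \<notin> set (succs rs u)} =
    {a..<a + src (drop a rs)}"
  using assms(2)
proof (induction a rule: inc_induct)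
  case base
  then show ?case by simp
next
  case (step a)
  let ?n = "length rs" and ?k = "src (drop (Suc a) rs)"
  obtain s where s: "s \<le> ?k" "filter (\<lambda>j. j < ?k) (rs ! a) = [?k - s..<?k]"
      "src (drop a rs) = Suc (?k - s)"
    using valid_row[OF assms(1) step.hyps(2)] .
  have mem: "j \<in> set (rs ! a) \<longleftrightarrow> ?k - s \<le> j" if "j < ?k" for j
  proof -
    have "j \<in> set (filter (\<lambda>j. j < ?k) (rs ! a)) \<longleftrightarrow> j \<in> set [?k - s..<?k]"
      unfolding s(2) ..
    then show ?thesis using that by simp
  qed
  have split: "{a..<?n} = insert a {Suc a..<?n}" using step.hyps by auto
  have "a \<notin> set (succs rs u)" if "u \<in> {a..<?n}" for u
    using succs_props(2)[OF assms(1), of u] that by auto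
  then have "{w \<in> {a..<?n}. \<forall>u \<in> {a..<?n}. w \<notin> set (succs rs u)} =
      insert a ({w \<in> {Suc a..<?n}. \<forall>u \<in> {Suc a..<?n}. w \<notin> set (succs rs u)} - set (succs rs a))"
    unfolding split by auto
  also have "\<dots> = insert a ({Suc a..<Suc a + ?k} - set (succs rs a))"
    using step.IH by simp
  also have "{Suc a..<Suc a + ?k} - set (succs rs a) = {Suc a..<Suc a + (?k - s)}"
  proof -
    have "w \<in> set (succs rs a) \<longleftrightarrow> Suc a + (?k - s) \<le> w" if "w \<in> {Suc a..<Suc a + ?k}" for w
    proof -
      define j where "j = w - Suc a"
      have w: "w = Suc (a + j)" and j: "j < ?k" using that unfolding j_def by auto
      have "w \<in> set (succs rs a) \<longleftrightarrow> j \<in> set (rs ! a)" unfolding w succs_def by auto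
      then show ?thesis unfolding mem[OF j] w by simp
    qed
    then show ?thesis by auto
  qed
  also have "insert a {Suc a..<Suc a + (?k - s)} = {a..<a + src (drop a rs)}"
    unfolding s(3) by (simp add: set_eq_iff) presburger
  finally show ?case .
qed

lemma decode_lists:
  assumes "valid_code rs"
  shows "doag_lists (decode rs) (succs rs) [0..<src rs]"
proof -
  have "edges (decode rs) \<subseteq> less_than"
    using succs_props(2)[OF assms] by (fastforce simp: decode_def)
  then have "acyclic (edges (decode rs))"
    using acyclic_subset wf_acyclic wf_less_than by blast
  moreover have "sources (decode rs) =
      {w \<in> {0..<length rs}. \<forall>u \<in> {0..<length rs}. w \<notin> set (succs rs u)}"
    by (auto simp: sources_def decode_def)
  then have "sources (decode rs) = {0..<src rs}"
    using tail_sources[OF assms, of 0] by simp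
  moreover have "set (succs rs i) \<subseteq> {..<length rs}" if "i < length rs" for i
    using succs_props(2)[OF assms that] by auto
  ultimately show ?thesis
    using succs_props(1)[OF assms] unfolding doag_lists_def
    by (simp add: decode_def case_prod_unfold atLeast0LessThan)
qed

section \<open>Canonical enumeration and rigidity\<close>

text \<open>Defined from the graph alone, without a code, so that it is preserved by isomorphisms.
  Here \<open>n\<close> bounds the number of deletions, \<open>V\<close> holds the vertices still
  present, and the filter keeps the successors of \<open>v\<close> that lose their last
  predecessor.\<close>

primrec removal_order :: "('a \<Rightarrow> 'a list) \<Rightarrow> nat \<Rightarrow> 'a set \<Rightarrow> 'a list \<Rightarrow> 'a list" where
  "removal_order out 0 V ss = []"
| "removal_order out (Suc n) V ss = (case ss of [] \<Rightarrow> [] | v # ss' \<Rightarrow>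
     v # removal_order out n (V - {v}) (ss' @ filter (\<lambda>w. \<forall>u \<in> V - {v}. w \<notin> set (out u)) (out v)))"

text \<open>The procedure consults only \<open>V\<close>, \<open>out\<close> and \<open>ss\<close>,
  so it commutes with renaming. The fixed closed set \<open>U\<close> keeps the hypotheses on
  \<open>out\<close> unchanged while \<open>V\<close> shrinks.\<close>

lemma removal_order_map:
  assumes inj: "inj_on f U" and out: "\<And>v. v \<in> U \<Longrightarrow> out' (f v) = map f (out v)"
    and closed: "\<And>v. v \<in> U \<Longrightarrow> set (out v) \<subseteq> U"
    and "V \<subseteq> U" "set ss \<subseteq> U"
  shows "removal_order out' n (f ` V) (map f ss) = map f (removal_order out n V ss)"
  using assms(4,5)
proof (induction n arbitrary: V ss)
  case (Suc n)
  show ?case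
  proof (cases ss)
    case (Cons v ss')
    have v: "v \<in> U" using Suc.prems Cons by simp
    have V: "f ` V - {f v} = f ` (V - {v})"
      using inj v Suc.prems(1) by (auto simp: inj_on_def)
    let ?P = "\<lambda>w. \<forall>u \<in> V - {v}. w \<notin> set (out u)"
    let ?P' = "\<lambda>w. \<forall>u \<in> f ` (V - {v}). w \<notin> set (out' u)"
    have "?P' (f w) \<longleftrightarrow> ?P w" if "w \<in> U" for w
    proof -
      have "f w \<notin> set (out' (f u)) \<longleftrightarrow> w \<notin> set (out u)" if "u \<in> V" for u
      proof -
        have "u \<in> U" using that Suc.prems(1) by auto
        then have "f w \<in> f ` set (out u) \<longleftrightarrow> w \<in> set (out u)"
          using inj_on_image_mem_iff[OF inj \<open>w \<in> U\<close> closed] by simp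
        then show ?thesis using out \<open>u \<in> U\<close> by simp
      qed
      then show ?thesis by auto
    qed
    then have "filter ?P' (map f (out v)) = map f (filter ?P (out v))"
      using closed[OF v] by (auto simp: filter_map o_def intro!: arg_cong[of _ _ "map f"] filter_cong)
    moreover have "set (ss' @ filter ?P (out v)) \<subseteq> U"
      using Suc.prems(2) Cons closed[OF v] by auto
    ultimately show ?thesis
      using Suc.IH[of "V - {v}" "ss' @ filter ?P (out v)"] Suc.prems(1) out[OF v] Cons V by auto
  qed simp
qed simp

text \<open>Vertices of a decoded graph are numbered by removal: the surviving sources followed by
  the \<open>s\<close> exposed ones form an interval again, which is the source list of the next
  suffix.\<close>

lemma removal_order_decode:
  assumes "valid_code rs" "a \<le> length rs"
  shows "removal_order (succs rs) (length rs - a) {a..<length rs} [a..<a + src (drop a rs)] = [a..<length rs]"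
  using assms(2)
proof (induction a rule: inc_induct)
  case base
  then show ?case by simp
next
  case (step a)
  let ?n = "length rs" and ?k = "src (drop (Suc a) rs)"
  let ?P = "\<lambda>w. \<forall>u \<in> {Suc a..<?n}. w \<notin> set (succs rs u)"
  obtain s where s: "s \<le> ?k" "filter (\<lambda>j. j < ?k) (rs ! a) = [?k - s..<?k]"
      "src (drop a rs) = Suc (?k - s)"
    using valid_row[OF assms(1) step.hyps(2)] .
  have "?P (Suc (a + j)) \<longleftrightarrow> j < ?k" if "j \<in> set (rs ! a)" for j
  proof -
    have "Suc (a + j) \<in> set (succs rs a)" using that by (auto simp: succs_def)
    then have "Suc (a + j) < ?n" using succs_props(2)[OF assms(1) step.hyps(2)] by auto
    then have "?P (Suc (a + j)) \<longleftrightarrow> Suc (a + j) \<in> {Suc a..<Suc a + ?k}"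
      using arg_cong[OF tail_sources[OF assms(1), of "Suc a"], of "\<lambda>A. Suc (a + j) \<in> A"]
        step.hyps by simp
    then show ?thesis by simp
  qed
  then have "filter ?P (succs rs a) = map (\<lambda>j. Suc (a + j)) (filter (\<lambda>j. j < ?k) (rs ! a))"
    unfolding succs_def[of rs a] filter_map o_def
    by (intro arg_cong[of _ _ "map _"] filter_cong) auto
  also have "\<dots> = [Suc a + (?k - s)..<Suc a + ?k]"
    unfolding s(2) by (simp add: list_eq_iff_nth_eq del: upt_Suc)
  finally have new: "filter ?P (succs rs a) = [Suc a + (?k - s)..<Suc a + ?k]" .
  have n: "?n - a = Suc (?n - Suc a)" using step.hyps by simp
  have V: "{a..<?n} - {a} = {Suc a..<?n}" by auto
  have "[Suc a..<Suc a + (?k - s)] @ [Suc a + (?k - s)..<Suc a + ?k] = [Suc a..<Suc a + ?k]"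
    using s(1) upt_add_eq_append[of "Suc a" "Suc a + (?k - s)" s] by simp
  moreover have "[a..<a + src (drop a rs)] = a # [Suc a..<Suc a + (?k - s)]"
    using s(3) by (simp add: upt_conv_Cons)
  ultimately have "removal_order (succs rs) (?n - a) {a..<?n} [a..<a + src (drop a rs)] =
      a # removal_order (succs rs) (?n - Suc a) {Suc a..<?n} [Suc a..<Suc a + ?k]"
    unfolding n using V new by (simp only: removal_order.simps list.case)
  also have "\<dots> = a # [Suc a..<?n]" using step.IH by simp
  finally show ?case using step.hyps by (simp add: upt_conv_Cons)
qed

text \<open>Rigidity: an isomorphism carries one removal order to the other, and both are
  \<open>[0..<length rs]\<close>, so \<open>f\<close> fixes every vertex.\<close>

lemma decode_inject:
  assumes "valid_code rs" "valid_code rs'" "doag_isomorphism f (decode rs) (decode rs')"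
  shows "rs = rs'"
proof -
  let ?n = "length rs"
  have bij: "bij_betw f {..<?n} {..<length rs'}"
    using assms(3) by (simp add: doag_isomorphism_def decode_def)
  then have n: "length rs' = ?n" using bij_betw_same_card by fastforce
  have lists: "\<And>v. v < ?n \<Longrightarrow> succs rs' (f v) = map f (succs rs v)"
      "[0..<src rs'] = map f [0..<src rs]"
    using doag_isomorphism_lists[OF decode_lists decode_lists, OF assms]
    by (simp_all add: decode_def)
  have "[0..<?n] = removal_order (succs rs') ?n (f ` {..<?n}) (map f [0..<src rs])"
    using removal_order_decode[OF assms(2), of 0] lists(2) n bij
    by (simp add: bij_betw_def atLeast0LessThan)
  also have "\<dots> = map f (removal_order (succs rs) ?n {..<?n} [0..<src rs])"
  proof (rule removal_order_map[where U = "{..<?n}"])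
    show "set (succs rs v) \<subseteq> {..<?n}" if "v \<in> {..<?n}" for v
      using succs_props(2)[OF assms(1)] that by fastforce
  qed (use bij lists(1) src_le_length[of rs] in \<open>auto simp: bij_betw_def\<close>)
  also have "\<dots> = map f [0..<?n]"
    using removal_order_decode[OF assms(1), of 0] by (simp add: atLeast0LessThan)
  finally have eq: "[0..<?n] = map f [0..<?n]" .
  have f: "f i = i" if "i < ?n" for i
    using arg_cong[OF eq, of "\<lambda>xs. xs ! i"] that by simp
  have "rs' ! i = rs ! i" if i: "i < ?n" for i
  proof -
    have "map f (succs rs i) = succs rs i"
      using succs_props(2)[OF assms(1) i] f by (intro map_idI) auto
    then have "succs rs' i = succs rs i" using lists(1)[OF i] f[OF i] by simp
    then show ?thesis
      unfolding succs_def by (subst (asm) inj_map_eq_map) (auto simp: inj_def)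
  qed
  then show ?thesis using n by (auto simp: list_eq_iff_nth_eq)
qed

text \<open>Stated for arbitrary \<open>V\<close>, \<open>out\<close> and \<open>ss\<close>, so that
  deleting the head of \<open>ss\<close> leaves another instance with the same \<open>out\<close>.
  The list \<open>xs\<close> is the removal order; the row of the deleted vertex consists of the
  positions of its successors in the \<open>xs\<close> of the remainder.\<close>

lemma exists_code:
  fixes V :: "'a set"
  assumes "finite V" "\<And>v. v \<in> V \<Longrightarrow> distinct (out v) \<and> set (out v) \<subseteq> V"
    "acyclic {(v, w). v \<in> V \<and> w \<in> set (out v)}"
    "distinct ss" "set ss = {v \<in> V. \<forall>u \<in> V. v \<notin> set (out u)}"
  shows "\<exists>xs rs. valid_code rs \<and> length rs = length xs \<and> distinct xs \<and> set xs = V \<and>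
    src rs = length ss \<and> take (length ss) xs = ss \<and>
    (\<forall>i < length xs. out (xs ! i) = map (\<lambda>j. xs ! Suc (i + j)) (rs ! i))"
  using assms
proof (induction "card V" arbitrary: V ss)
  case 0
  then have "V = {}" "ss = []" by auto
  then show ?case by (intro exI[of _ "[]"]) auto
next
  case (Suc n)
  let ?R = "{(v, w). v \<in> V \<and> w \<in> set (out v)}"
  have "?R \<subseteq> V \<times> V" using Suc.prems(2) by auto
  then have wf: "wf ?R" using Suc.prems(1,3) by (meson finite_SigmaI finite_acyclic_wf finite_subset)
  obtain a where a: "a \<in> V" using Suc.hyps(2) by fastforce
  \<comment> \<open>A minimal element of the edge relation has no predecessor, so a nonempty graph
    has a source to delete.\<close>
  have "\<exists>z \<in> V. \<forall>u. (u, z) \<in> ?R \<longrightarrow> u \<notin> V"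
    by (rule wf[unfolded wf_eq_minimal, rule_format, OF a])
  then obtain z where "z \<in> V" "\<forall>u. (u, z) \<in> ?R \<longrightarrow> u \<notin> V" by blast
  then have "z \<in> set ss" unfolding Suc.prems(5) by blast
  then obtain v ss0 where ss: "ss = v # ss0" by (cases ss) auto
  define V' where "V' = V - {v}"
  define P where "P w \<longleftrightarrow> (\<forall>u \<in> V'. w \<notin> set (out u))" for w
  define new where "new = filter P (out v)"
  have v: "v \<in> V" "\<And>u. u \<in> V \<Longrightarrow> v \<notin> set (out u)" using Suc.prems(5) ss by auto
  have outV': "set (out u) \<subseteq> V'" if "u \<in> V" for u
    using Suc.prems(2)[OF that] v(2)[OF that] unfolding V'_def by auto
  have set_new: "set (ss0 @ new) = {w \<in> V'. \<forall>u \<in> V'. w \<notin> set (out u)}"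
  proof -
    have "set ss0 = {w \<in> V'. \<forall>u \<in> V. w \<notin> set (out u)}"
      using Suc.prems(4,5) ss unfolding V'_def by auto
    moreover have "set new = {w \<in> V'. w \<in> set (out v) \<and> P w}"
      using outV'[OF v(1)] unfolding new_def by auto
    moreover have "V = insert v V'" using v(1) unfolding V'_def by auto
    ultimately show ?thesis unfolding P_def by auto
  qed
  have "set ss0 \<inter> set new = {}" using Suc.prems(5) ss v(1) unfolding new_def by auto
  then have dist: "distinct (ss0 @ new)"
    using Suc.prems(2)[OF v(1)] Suc.prems(4) ss unfolding new_def by auto
  have "n = card V'" using Suc.hyps(2) Suc.prems(1) v(1) unfolding V'_def by simp
  moreover have "acyclic {(v, w). v \<in> V' \<and> w \<in> set (out v)}"
    using Suc.prems(3) by (rule acyclic_subset) (auto simp: V'_def)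
  moreover have "finite V'" "\<And>u. u \<in> V' \<Longrightarrow> distinct (out u) \<and> set (out u) \<subseteq> V'"
    using Suc.prems(1,2) outV' unfolding V'_def by auto
  ultimately obtain xs rs where IH: "valid_code rs" "length rs = length xs" "distinct xs" "set xs = V'"
      "src rs = length (ss0 @ new)" "take (length (ss0 @ new)) xs = ss0 @ new"
      "\<And>i. i < length xs \<Longrightarrow> out (xs ! i) = map (\<lambda>j. xs ! Suc (i + j)) (rs ! i)"
    using Suc.hyps(1)[of V' "ss0 @ new"] set_new dist by blast
  let ?k = "length (ss0 @ new)"
  have bij: "bij_betw (nth xs) {..<length xs} V'"
    using IH(3,4) by (simp add: bij_betw_nth)
  then have inj: "inj_on (nth xs) {..<length xs}" by (simp add: bij_betw_def)
  define r where "r = map (inv_into {..<length xs} (nth xs)) (out v)"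
  have mapr: "map (nth xs) r = out v"
    using outV'[OF v(1)] bij unfolding r_def map_map
    by (intro map_idI) (auto simp: bij_betw_inv_into_right subset_iff)
  have distr: "distinct r" using mapr Suc.prems(2)[OF v(1)] by (metis distinct_map)
  have setr: "set r \<subseteq> {..<length xs}"
    using outV'[OF v(1)] bij_betw_apply[OF bij_betw_inv_into[OF bij]] unfolding r_def by auto
  have k: "?k \<le> length xs" using src_le_length[of rs] IH(2,5) by simp
  have P_iff: "P (xs ! j) \<longleftrightarrow> j < ?k" if "j < length xs" for j
  proof -
    have "xs ! j \<in> V'" using nth_mem[OF that] IH(4) by simp
    moreover have "set (take ?k xs) = {w \<in> V'. P w}" unfolding IH(6) set_new P_def ..
    ultimately have "P (xs ! j) \<longleftrightarrow> xs ! j \<in> set (take ?k xs)" by simp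
    also have "\<dots> \<longleftrightarrow> j < ?k"
      using k that nth_eq_iff_index_eq[OF IH(3)] unfolding in_set_conv_nth
      by (auto simp del: length_append)
    finally show ?thesis .
  qed
  have "map (nth xs) (filter (\<lambda>j. j < ?k) r) = map (nth xs) (filter (\<lambda>j. P (xs ! j)) r)"
    using P_iff setr by (intro arg_cong[of _ _ "map _"] filter_cong) auto
  also have "\<dots> = new" unfolding new_def mapr[symmetric] by (simp add: filter_map o_def)
  \<comment> \<open>The sources of the remainder are the prefix \<open>ss0 @ new\<close> of
    \<open>xs\<close>, so \<open>new\<close> occupies the positions from \<open>length ss0\<close>
    on. Injectivity of \<open>nth xs\<close> turns this into the filter condition of
    \<open>valid_code\<close>.\<close>
  also have "new = map (nth xs) [length ss0..<?k]"
  proof -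
    have new: "new = drop (length ss0) (take ?k xs)" unfolding IH(6) by simp
    have "drop (length ss0) (take ?k xs) = map (nth xs) [length ss0..<?k]"
      using k by (intro nth_equalityI) (simp_all del: length_append upt_Suc)
    then show ?thesis by (rule trans[OF new])
  qed
  finally have row: "filter (\<lambda>j. j < ?k) r = [length ss0..<?k]"
    using inj setr k by (subst (asm) inj_on_map_eq_map) (auto intro: inj_on_subset)
  have "valid_code (r # rs)"
    using IH(1,2,5) distr setr row by (auto intro!: exI[of _ "length new"])
  moreover have "src (r # rs) = length ss" using IH(5) row ss by simp
  moreover have "distinct (v # xs)" "set (v # xs) = V"
    using IH(3,4) v(1) unfolding V'_def by auto
  moreover have "take (length ss) (v # xs) = ss"
    using arg_cong[OF IH(6), of "take (length ss0)"] ss by simp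
  moreover have "out ((v # xs) ! i) = map (\<lambda>j. (v # xs) ! Suc (i + j)) ((r # rs) ! i)"
    if "i < length (v # xs)" for i
    using that mapr IH(7) by (cases i) auto
  ultimately show ?case using IH(2) by (intro exI[of _ "v # xs"] exI[of _ "r # rs"]) simp
qed

lemma doag_isomorphic_decode:
  assumes "is_doag G"
  obtains f rs where "valid_code rs" "length rs = card (verts G)" "src rs = card (sources G)"
    "doag_isomorphism f (decode rs) G"
proof -
  obtain out ss where G: "doag_lists G out ss" using is_doag_obtain_lists[OF assms] .
  have E: "edges G = {(v, w). v \<in> verts G \<and> w \<in> set (out v)}"
    using G unfolding doag_lists_def by blast
  have "set ss = {v \<in> verts G. \<forall>u \<in> verts G. v \<notin> set (out u)}"
    using G E unfolding doag_lists_def sources_def by auto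
  then obtain xs rs where xs: "valid_code rs" "length rs = length xs" "distinct xs" "set xs = verts G"
    "src rs = length ss" "take (length ss) xs = ss"
    "\<And>i. i < length xs \<Longrightarrow> out (xs ! i) = map (\<lambda>j. xs ! Suc (i + j)) (rs ! i)"
    using exists_code[of "verts G" out ss] G E unfolding doag_lists_def by (auto 0 3)
  have "length rs = card (verts G)" using xs(2-4) distinct_card by metis
  moreover have "src rs = card (sources G)"
    using G xs(5) unfolding doag_lists_def by (metis distinct_card)
  moreover have "doag_isomorphism (nth xs) (decode rs) G"
  proof (rule doag_isomorphismI[OF decode_lists[OF xs(1)] G])
    show "bij_betw (nth xs) (verts (decode rs)) (verts G)"
      using xs(2-4) by (simp add: decode_def bij_betw_nth)
    show "out (xs ! v) = map (nth xs) (succs rs v)" if "v \<in> verts (decode rs)" for v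
      using that xs(2,7) by (simp add: decode_def succs_def o_def)
    show "ss = map (nth xs) [0..<src rs]"
    proof (rule nth_equalityI)
      fix i assume "i < length ss"
      then show "ss ! i = map (nth xs) [0..<src rs] ! i"
        using xs(5) nth_take[of i "length ss" xs] unfolding xs(6) by simp
    qed (simp add: xs(5))
  qed
  ultimately show ?thesis using that xs(1) by blast
qed

section \<open>Isomorphism classes counted by codes\<close>

text \<open>Every class contains exactly one decoded code. The predicate \<open>P\<close> serves
  both counts: all graphs, and those with one source.\<close>

lemma card_doag_classes:
  "card ({G :: nat doag. is_doag G \<and> card (verts G) = n \<and> P (card (sources G))} // doag_iso) =
    card {rs. valid_code rs \<and> length rs = n \<and> P (src rs)}" (is "card (?S // _) = card ?C")
proof -
  have dec: "decode rs \<in> ?S" if "rs \<in> ?C" for rs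
  proof -
    have "doag_lists (decode rs) (succs rs) [0..<src rs]" using that decode_lists by auto
    then have "is_doag (decode rs)" "sources (decode rs) = {0..<src rs}"
      using doag_lists_imp_is_doag by (blast, simp add: doag_lists_def)
    then show ?thesis using that by (simp add: decode_def)
  qed
  have "bij_betw (\<lambda>rs. doag_iso `` {decode rs}) ?C (?S // doag_iso)"
    unfolding bij_betw_def
  proof (intro conjI inj_onI equalityI subsetI)
    fix rs rs' assume rs: "rs \<in> ?C" "rs' \<in> ?C"
      and eq: "doag_iso `` {decode rs} = doag_iso `` {decode rs'}"
    have "(decode rs, decode rs') \<in> doag_iso"
      using eq_equiv_class[OF eq equiv_doag_iso] dec[OF rs(2)] by simp
    then show "rs = rs'" using rs decode_inject unfolding doag_iso_def by auto
  next
    fix X assume "X \<in> (\<lambda>rs. doag_iso `` {decode rs}) ` ?C"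
    then show "X \<in> ?S // doag_iso" using dec by (auto intro!: quotientI)
  next
    fix X assume "X \<in> ?S // doag_iso"
    then obtain G where G: "G \<in> ?S" "X = doag_iso `` {G}" by (rule quotientE)
    then obtain f rs where rs: "valid_code rs" "length rs = card (verts G)" "src rs = card (sources G)"
        "doag_isomorphism f (decode rs) G"
      using doag_isomorphic_decode by blast
    then have C: "rs \<in> ?C" using G(1) by simp
    have "(decode rs, G) \<in> doag_iso"
      using rs(4) G(1) dec[OF C] unfolding doag_iso_def by auto
    then have "X = doag_iso `` {decode rs}"
      using equiv_class_eq[OF equiv_doag_iso] G(2) by blast
    then show "X \<in> (\<lambda>rs. doag_iso `` {decode rs}) ` ?C" using C by blast
  qed
  from bij_betw_same_card[OF this] show ?thesis by (rule sym)
qed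

definition codes :: "nat \<Rightarrow> nat \<Rightarrow> nat list list set" where
  "codes n k = {rs. valid_code rs \<and> length rs = n \<and> src rs = k}"

lemma finite_codes_length: "finite {rs. valid_code rs \<and> length rs = n}"
proof (induction n)
  case (Suc n)
  have "finite {r. set r \<subseteq> {..<n} \<and> distinct r}"
    by (rule finite_subset_distinct) simp
  moreover have "{rs. valid_code rs \<and> length rs = Suc n} \<subseteq> (\<lambda>(r, rs). r # rs) `
      ({r. set r \<subseteq> {..<n} \<and> distinct r} \<times> {rs. valid_code rs \<and> length rs = n})"
    by (auto simp: length_Suc_conv image_iff)
  ultimately show ?case using Suc by (meson finite_SigmaI finite_imageI finite_subset)
qed simp

lemma finite_codes: "finite (codes n k)"
  by (rule finite_subset[OF _ finite_codes_length[of n]]) (auto simp: codes_def)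

lemma D_star_eq: "D_star n = card (codes n 1)"
  using card_doag_classes[of n "\<lambda>k. k = 1"] unfolding D_star_def codes_def .

lemma D_eq: "D n = (\<Sum>k\<le>n. card (codes n k))"
proof -
  have "D n = card {rs. valid_code rs \<and> length rs = n}"
    using card_doag_classes[of n "\<lambda>_. True"] unfolding D_def simp_thms .
  also have "{rs. valid_code rs \<and> length rs = n} = (\<Union>k\<le>n. codes n k)"
    using src_le_length by (auto simp: codes_def simp del: length_0_conv)
  also have "card \<dots> = (\<Sum>k\<le>n. card (codes n k))"
  proof (rule card_UN_disjoint)
    show "\<forall>k\<in>{..n}. finite (codes n k)" by (simp add: finite_codes)
  qed (auto simp: codes_def)
  finally show ?thesis .
qed

section \<open>The recurrence\<close>

text \<open>\<open>weight s u\<close> counts the rows that expose \<open>s\<close> new sources and may also refer to \<open>u\<close> vertices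
  that are not sources of the remainder.\<close>

definition weight :: "nat \<Rightarrow> nat \<Rightarrow> nat" where
  "weight s u = (\<Sum>i\<le>u. (u choose i) * fact i * ((s + i) choose s))"

lemma card_distinct_lists:
  assumes "finite A" "i \<le> card A"
  shows "card {ys. length ys = i \<and> distinct ys \<and> set ys \<subseteq> A} = (card A choose i) * fact i"
proof -
  have "card {ys. length ys = i \<and> distinct ys \<and> set ys \<subseteq> A} = \<Prod>{card A - i + 1..card A}"
    using card_lists_distinct_length_eq[OF assms] .
  also have "\<dots> = fact (card A) div fact (card A - i)"
    by (simp add: fact_div_fact)
  also have "\<dots> = (card A choose i) * fact i"
    using binomial_fact_lemma[OF assms(2)]
    by (metis div_mult_self_is_m fact_gt_zero mult.assoc mult.commute)
  finally show ?thesis .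
qed

text \<open>Such a row is a shuffle of the forced list \<open>z\<close> with a duplicate-free list
  over \<open>B\<close>. Filtering recovers the latter from the row, so different lists have
  disjoint sets of shuffles.\<close>

lemma card_rows:
  assumes "finite A" "finite B" "A \<inter> B = {}" "distinct z" "set z \<subseteq> A"
  shows "card {r. distinct r \<and> set r \<subseteq> A \<union> B \<and> filter (\<lambda>x. x \<in> A) r = z} =
    weight (length z) (card B)"
proof -
  define L where "L i = {ys. length ys = i \<and> distinct ys \<and> set ys \<subseteq> B}" for i
  have finL: "finite (L i)" for i
    unfolding L_def using finite_subset_distinct[OF assms(2)] by (rule finite_subset[rotated]) auto
  have disj: "set z \<inter> set ys = {}" if "ys \<in> L i" for ys i
    using that assms(3,5) unfolding L_def by auto
  have filters: "filter (\<lambda>x. x \<in> A) r = z" "filter (\<lambda>x. x \<notin> A) r = ys"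
    if "ys \<in> L i" "r \<in> shuffles z ys" for ys i r
  proof -
    have 1: "filter (\<lambda>x. x \<in> A) z = z" "filter (\<lambda>x. x \<in> A) ys = []"
      "filter (\<lambda>x. x \<notin> A) z = []" "filter (\<lambda>x. x \<notin> A) ys = ys"
      using that(1) assms(3,5) by (auto simp: L_def filter_id_conv filter_empty_conv)
    show "filter (\<lambda>x. x \<in> A) r = z"
      using filter_shuffles[of "\<lambda>x. x \<in> A" z ys] that(2) 1 by auto
    show "filter (\<lambda>x. x \<notin> A) r = ys"
      using filter_shuffles[of "\<lambda>x. x \<notin> A" z ys] that(2) 1 by auto
  qed
  have "{r. distinct r \<and> set r \<subseteq> A \<union> B \<and> filter (\<lambda>x. x \<in> A) r = z} =
      (\<Union>i\<le>card B. \<Union>ys\<in>L i. shuffles z ys)"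
  proof (intro equalityI subsetI)
    fix r assume r: "r \<in> {r. distinct r \<and> set r \<subseteq> A \<union> B \<and> filter (\<lambda>x. x \<in> A) r = z}"
    let ?ys = "filter (\<lambda>x. x \<notin> A) r"
    have "set ?ys \<subseteq> B" using r by auto
    moreover have "distinct ?ys" using r by simp
    ultimately have "?ys \<in> L (length ?ys)" "length ?ys \<le> card B"
      using card_mono[OF assms(2), of "set ?ys"] distinct_card[of ?ys] by (auto simp: L_def)
    moreover have "r \<in> shuffles z ?ys" using partition_in_shuffles[of r "\<lambda>x. x \<in> A"] r by auto
    ultimately show "r \<in> (\<Union>i\<le>card B. \<Union>ys\<in>L i. shuffles z ys)" by blast
  next
    fix r assume "r \<in> (\<Union>i\<le>card B. \<Union>ys\<in>L i. shuffles z ys)"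
    then obtain i ys where ys: "ys \<in> L i" "r \<in> shuffles z ys" by auto
    then have "distinct r"
      using distinct_disjoint_shuffles[of z ys r] disj[OF ys(1)] assms(4) by (auto simp: L_def)
    moreover have "set r = set z \<union> set ys" using set_shuffles[OF ys(2)] .
    ultimately show "r \<in> {r. distinct r \<and> set r \<subseteq> A \<union> B \<and> filter (\<lambda>x. x \<in> A) r = z}"
      using filters[OF ys] ys(1) assms(5) by (auto simp: L_def)
  qed
  also have "card \<dots> = (\<Sum>i\<le>card B. card (\<Union>ys\<in>L i. shuffles z ys))"
  proof (rule card_UN_disjoint)
    show "\<forall>i\<in>{..card B}. finite (\<Union>ys\<in>L i. shuffles z ys)" using finL by auto
    show "\<forall>i\<in>{..card B}. \<forall>j\<in>{..card B}. i \<noteq> j \<longrightarrow>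
        (\<Union>ys\<in>L i. shuffles z ys) \<inter> (\<Union>ys\<in>L j. shuffles z ys) = {}"
    proof (intro ballI impI, rule ccontr)
      fix i j assume "i \<noteq> j" "(\<Union>ys\<in>L i. shuffles z ys) \<inter> (\<Union>ys\<in>L j. shuffles z ys) \<noteq> {}"
      then obtain r ys ys' where "ys \<in> L i" "r \<in> shuffles z ys" "ys' \<in> L j" "r \<in> shuffles z ys'"
        by auto
      then have "ys = ys'" using filters(2) by metis
      then show False using \<open>ys \<in> L i\<close> \<open>ys' \<in> L j\<close> \<open>i \<noteq> j\<close> by (simp add: L_def)
    qed
  qed simp
  also have "\<dots> = (\<Sum>i\<le>card B. (card B choose i) * fact i * ((length z + i) choose length z))"
  proof (rule sum.cong)
    fix i assume i: "i \<in> {..card B}"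
    have "card (\<Union>ys\<in>L i. shuffles z ys) = (\<Sum>ys\<in>L i. card (shuffles z ys))"
    proof (rule card_UN_disjoint)
      show "\<forall>ys\<in>L i. \<forall>ys'\<in>L i. ys \<noteq> ys' \<longrightarrow> shuffles z ys \<inter> shuffles z ys' = {}"
        using filters(2) by blast
    qed (use finL in auto)
    also have "\<dots> = (\<Sum>ys\<in>L i. (length z + i) choose length z)"
      by (rule sum.cong) (use disj[of _ i] in \<open>auto simp: L_def card_disjoint_shuffles\<close>)
    also have "\<dots> = (card B choose i) * fact i * ((length z + i) choose length z)"
      using card_distinct_lists[OF assms(2), of i] i by (simp add: L_def)
    finally show "card (\<Union>ys\<in>L i. shuffles z ys) =
        (card B choose i) * fact i * ((length z + i) choose length z)" .
  qed simp
  finally show ?thesis by (simp add: weight_def)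
qed

text \<open>Here \<open>k\<close> counts the sources other than the deleted one, so the remainder
  has \<open>k + s\<close> sources, of which the last \<open>s\<close> are forced into the row. For
  fixed \<open>s\<close>, row and remainder are independent.\<close>

lemma card_codes_Suc:
  assumes "k \<le> n"
  shows "card (codes (Suc n) (Suc k)) =
    (\<Sum>s\<le>n - k. card (codes n (k + s)) * weight s (n - k - s))"
proof -
  define R where "R s = {r. distinct r \<and> set r \<subseteq> {..<k + s} \<union> {k + s..<n} \<and>
      filter (\<lambda>j. j \<in> {..<k + s}) r = [k..<k + s]}" for s
  have cardR: "card (R s) = weight s (n - k - s)" for s
    using card_rows[of "{..<k + s}" "{k + s..<n}" "[k..<k + s]"] unfolding R_def by fastforce
  have finR: "finite (R s)" for s
    unfolding R_def
    by (rule finite_subset[OF _ finite_subset_distinct[of "{..<k + s} \<union> {k + s..<n}"]]) auto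
  have "codes (Suc n) (Suc k) = (\<lambda>(r, rs). r # rs) ` (\<Union>s\<le>n - k. R s \<times> codes n (k + s))"
  proof (intro equalityI subsetI)
    fix c assume "c \<in> codes (Suc n) (Suc k)"
    then obtain r rs where c: "c = r # rs" "length rs = n" "valid_code (r # rs)" "src (r # rs) = Suc k"
      by (auto simp: codes_def length_Suc_conv)
    obtain s where s: "s \<le> src rs" "filter (\<lambda>j. j < src rs) r = [src rs - s..<src rs]"
      using c(3) by auto
    have src: "src rs = k + s" using s c(4) by simp
    have n: "k + s \<le> n" using src_le_length[of rs] src c(2) by simp
    have "r \<in> R s"
      using c(2,3) s(2) src n by (auto simp: R_def)
    moreover have "rs \<in> codes n (k + s)" using c src by (simp add: codes_def)
    moreover have "s \<le> n - k" using n by simp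
    ultimately show "c \<in> (\<lambda>(r, rs). r # rs) ` (\<Union>s\<le>n - k. R s \<times> codes n (k + s))"
      using c(1) by (auto simp: image_iff)
  next
    fix c assume "c \<in> (\<lambda>(r, rs). r # rs) ` (\<Union>s\<le>n - k. R s \<times> codes n (k + s))"
    then obtain s r rs where c: "s \<le> n - k" "r \<in> R s" "rs \<in> codes n (k + s)" "c = r # rs"
      by auto
    have f: "filter (\<lambda>j. j < k + s) r = [k..<k + s]" using c(2) by (simp add: R_def)
    have "set r \<subseteq> {..<n}" using c(1,2) assms by (fastforce simp: R_def)
    moreover have "\<exists>s'\<le>k + s. [k..<k + s] = [k + s - s'..<k + s]"
      by (rule exI[of _ s]) simp
    ultimately have "valid_code c" using c f by (simp add: codes_def R_def)
    then show "c \<in> codes (Suc n) (Suc k)"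
      using c f by (simp add: codes_def)
  qed
  also have "card \<dots> = card (\<Union>s\<le>n - k. R s \<times> codes n (k + s))"
    by (rule card_image) (auto simp: inj_on_def)
  also have "\<dots> = (\<Sum>s\<le>n - k. card (R s \<times> codes n (k + s)))"
  proof (rule card_UN_disjoint)
    show "\<forall>s\<in>{..n - k}. finite (R s \<times> codes n (k + s))"
      using finR finite_codes by blast
  qed (auto simp: codes_def)
  also have "\<dots> = (\<Sum>s\<le>n - k. card (codes n (k + s)) * weight s (n - k - s))"
    by (simp add: card_cartesian_product cardR mult.commute)
  finally show ?thesis .
qed

lemma codes_0_1: "codes (Suc 0) 1 = {[[]]}"
  by (auto simp: codes_def length_Suc_conv)

lemma codes_Suc_0: "codes (Suc n) 0 = {}"
  by (auto simp: codes_def length_Suc_conv)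

section \<open>Asymptotics\<close>

text \<open>The differences of M/(n - 1) are M/((n - 1) n) >= M/n^2, so this telescoping majorant
  yields both the Cauchy property and the rate.\<close>

lemma quadratic_increments_converge:
  fixes x :: "nat \<Rightarrow> real"
  assumes "m \<ge> 2" and incr: "\<And>n. n \<ge> m \<Longrightarrow> \<bar>x (Suc n) - x n\<bar> \<le> M / (real n)\<^sup>2"
  shows "\<exists>L. \<forall>n\<ge>m. \<bar>x n - L\<bar> \<le> M / (real n - 1)"
proof -
  define h where "h n = M / (real n - 1)" for n
  have M: "0 \<le> M"
  proof -
    have "0 \<le> M / (real m)\<^sup>2" using incr[of m] by linarith
    then show ?thesis using assms(1) by (simp add: zero_le_divide_iff)
  qed
  have "M / (real n)\<^sup>2 \<le> h n - h (Suc n)" if "n \<ge> m" for n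
  proof -
    have "real n > 1" using that assms(1) by simp
    then have "h n - h (Suc n) = M / ((real n - 1) * real n)"
      unfolding h_def by (simp add: field_simps)
    moreover have "(real n - 1) * real n \<le> (real n)\<^sup>2" "0 < (real n - 1) * real n"
      using \<open>real n > 1\<close> by (auto simp: power2_eq_square algebra_simps)
    moreover have "0 < (real n)\<^sup>2" using \<open>real n > 1\<close> by simp
    ultimately show ?thesis using M divide_left_mono[of "(real n - 1) * real n" "(real n)\<^sup>2" M]
      by (simp add: mult_pos_pos)
  qed
  then have incr': "\<bar>x (Suc n) - x n\<bar> \<le> h n - h (Suc n)" if "n \<ge> m" for n
    using incr[OF that] that by fastforce
  have dist: "\<bar>x k - x n\<bar> \<le> h n - h k" if "m \<le> n" "n \<le> k" for n k
    using that(2)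
  proof (induction k rule: dec_induct)
    case (step k)
    then show ?case using incr'[of k] that(1) by linarith
  qed simp
  have h_lim: "h \<longlonglongrightarrow> 0" unfolding h_def by real_asymp
  have h_nonneg: "0 \<le> h n" if "m \<le> n" for n
    using that assms(1) M by (simp add: h_def)
  have "Cauchy x"
  proof (rule metric_CauchyI)
    fix e :: real assume "0 < e"
    then have "eventually (\<lambda>n. h n < e) sequentially"
      using h_lim by (simp add: order_tendsto_iff)
    then obtain n0 where n0: "\<And>n. n \<ge> n0 \<Longrightarrow> h n < e"
      by (auto simp: eventually_sequentially)
    show "\<exists>K. \<forall>p\<ge>K. \<forall>q\<ge>K. dist (x p) (x q) < e"
    proof (intro exI allI impI)
      fix p q assume pq: "max m n0 \<le> p" "max m n0 \<le> q"
      then have "\<bar>x p - x q\<bar> \<le> max (h p) (h q)"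
        using dist[of p q] dist[of q p] h_nonneg[of p] h_nonneg[of q] by (cases "p \<le> q") auto
      then show "dist (x p) (x q) < e" using n0[of p] n0[of q] pq by (simp add: dist_real_def)
    qed
  qed
  then obtain L where L: "x \<longlonglongrightarrow> L" using Cauchy_convergent convergent_def by blast
  have "\<bar>x n - L\<bar> \<le> h n" if "n \<ge> m" for n
  proof (rule tendsto_upperbound)
    show "(\<lambda>k. \<bar>x n - x k\<bar>) \<longlonglongrightarrow> \<bar>x n - L\<bar>" by (intro tendsto_intros L)
    show "eventually (\<lambda>k. \<bar>x n - x k\<bar> \<le> h n) sequentially"
      using eventually_ge_at_top[of n]
    proof eventually_elim
      case (elim k)
      then show ?case using dist[OF that elim] h_nonneg[of k] that by linarith
    qed
  qed simp
  then show ?thesis unfolding h_def by blast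
qed

text \<open>An infinite product with factors 1 + O(1/n^2): the logarithms have summable increments,
  and their limit \<open>L\<close> gives \<open>C = exp L\<close>.\<close>

lemma ratio_asymptotics:
  fixes b :: "nat \<Rightarrow> real"
  assumes pos: "eventually (\<lambda>n. b n > 0) sequentially"
    and ratio: "(\<lambda>n. b (Suc n) / b n - 1) \<in> O(\<lambda>n. 1 / (real n)\<^sup>2)"
  shows "\<exists>C > 0. (\<lambda>n. b n / C - 1) \<in> O(\<lambda>n. 1 / real n)"
proof -
  let ?c = "\<lambda>n. b (Suc n) / b n - 1"
  obtain c where c: "c > 0" "eventually (\<lambda>n. norm (?c n) \<le> c * norm (1 / (real n)\<^sup>2)) sequentially"
    using ratio by (rule landau_o.bigE)
  have "(\<lambda>n. c * (1 / (real n)\<^sup>2)) \<longlonglongrightarrow> 0" by real_asymp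
  then have "eventually (\<lambda>n. c * (1 / (real n)\<^sup>2) < 1 / 2) sequentially"
    by (rule order_tendstoD) simp
  with c(2) pos have
    "eventually (\<lambda>n. norm (?c n) \<le> c * norm (1 / (real n)\<^sup>2) \<and> norm (?c n) < 1 / 2 \<and> b n > 0) sequentially"
    proof eventually_elim
    case (elim n)
    have "norm (1 / (real n)\<^sup>2) = 1 / (real n)\<^sup>2" by simp
    then have "c * norm (1 / (real n)\<^sup>2) < 1 / 2" using elim(3) by (simp only:)
    then show ?case using elim(1,2) by linarith
  qed
  then obtain n0 where n0: "\<And>n. n \<ge> n0 \<Longrightarrow>
      norm (?c n) \<le> c * norm (1 / (real n)\<^sup>2) \<and> norm (?c n) < 1 / 2 \<and> b n > 0"
    unfolding eventually_sequentially by blast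
  define m where "m = max 2 n0"
  \<comment> \<open>For |x| <= 1/2, |ln (1 + x) - x| <= 2 x^2 <= |x| gives |ln (1 + x)| <= 2 |x|;
    hence the threshold 1/2 and the constant \<open>2 * c\<close>.\<close>
  have "\<bar>ln (b (Suc n)) - ln (b n)\<bar> \<le> (2 * c) / (real n)\<^sup>2" if "n \<ge> m" for n
  proof -
    have n: "\<bar>?c n\<bar> \<le> c / (real n)\<^sup>2" "\<bar>?c n\<bar> < 1 / 2" "b n > 0" "b (Suc n) > 0"
      using n0[of n] n0[of "Suc n"] that by (auto simp: m_def)
    have "ln (b (Suc n)) - ln (b n) = ln (1 + ?c n)" using n(3,4) by (simp add: ln_div)
    moreover have "\<bar>ln (1 + ?c n) - ?c n\<bar> \<le> 2 * (?c n)\<^sup>2"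
      using n(2) by (intro abs_ln_one_plus_x_minus_x_bound) simp
    moreover have "2 * (?c n)\<^sup>2 \<le> \<bar>?c n\<bar>"
    proof -
      have "2 * \<bar>?c n\<bar> * \<bar>?c n\<bar> \<le> 1 * \<bar>?c n\<bar>" using n(2) by (intro mult_right_mono) auto
      then show ?thesis by (simp add: power2_eq_square flip: abs_mult)
    qed
    ultimately show ?thesis using n(1) by linarith
  qed
  then obtain L where L: "\<And>n. n \<ge> m \<Longrightarrow> \<bar>ln (b n) - L\<bar> \<le> (2 * c) / (real n - 1)"
    using quadratic_increments_converge[of m "\<lambda>n. ln (b n)" "2 * c"] unfolding m_def by auto
  have "(\<lambda>n. (2 * c) / (real n - 1)) \<longlonglongrightarrow> 0" by real_asymp
  then have "eventually (\<lambda>n. (2 * c) / (real n - 1) < 1) sequentially"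
    by (rule order_tendstoD) simp
  then have "eventually (\<lambda>n. norm (b n / exp L - 1) \<le> 2 * norm ((2 * c) / (real n - 1))) sequentially"
    using eventually_ge_at_top[of m]
  proof eventually_elim
    case (elim n)
    define t where "t = ln (b n) - L"
    have t: "\<bar>t\<bar> \<le> (2 * c) / (real n - 1)" "\<bar>t\<bar> \<le> 1"
      using L[OF elim(2)] elim(1) by (auto simp: t_def)
    have "b n > 0" using n0[of n] elim(2) by (simp add: m_def)
    then have "b n / exp L - 1 = exp t - 1" by (simp add: t_def exp_diff)
    moreover have "\<bar>exp t - 1\<bar> \<le> 2 * \<bar>t\<bar>"
    proof (cases "t \<ge> 0")
      case True
      then have "exp t \<le> 1 + t + t\<^sup>2" using t(2) by (intro exp_bound) auto
      moreover have "t\<^sup>2 \<le> t" using True t(2) by (simp add: power2_eq_square mult_left_le)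
      ultimately show ?thesis using True by simp
    next
      case False
      then have "exp t < 1" by simp
      then show ?thesis using False exp_ge_add_one_self[of t] by linarith
    qed
    ultimately have "norm (b n / exp L - 1) \<le> 2 * \<bar>t\<bar>" unfolding real_norm_def by (simp only:)
    then show ?case using t(1) abs_ge_self[of "(2 * c) / (real n - 1)"]
      unfolding real_norm_def by linarith
  qed
  then have "(\<lambda>n. b n / exp L - 1) \<in> O(\<lambda>n. (2 * c) / (real n - 1))"
    by (rule bigoI)
  also have "(\<lambda>n. (2 * c) / (real n - 1)) \<in> O(\<lambda>n. 1 / real n)" by real_asymp
  finally show ?thesis by (intro exI[of _ "exp L"]) simp
qed

section \<open>Truncated exponential series and the size of the weights\<close>

definition exp_sum :: "nat \<Rightarrow> real" where
  "exp_sum m = (\<Sum>l<m. 1 / fact l)"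

lemma exp_sum_bounds: "exp_sum m \<le> exp 1" "exp 1 - exp_sum m \<le> exp 1 / fact m"
proof -
  obtain t where t: "\<bar>t\<bar> \<le> \<bar>1::real\<bar>" "exp 1 = (\<Sum>l<m. 1 ^ l / fact l) + exp t / fact m * 1 ^ m"
    using Maclaurin_exp_le by blast
  then have eq: "exp 1 - exp_sum m = exp t / fact m" by (simp add: exp_sum_def)
  then show "exp_sum m \<le> exp 1" by (metis diff_ge_0_iff_ge divide_nonneg_pos exp_ge_zero fact_gt_zero)
  show "exp 1 - exp_sum m \<le> exp 1 / fact m"
    unfolding eq using t(1) by (intro divide_right_mono) auto
qed

text \<open>Convergence is far faster, but only this order is used. The constant comes from n! >= n
  (n - 1) >= n^2/2 for n >= 2.\<close>

lemma exp_sum_asymp: "(\<lambda>n. exp_sum n - exp 1) \<in> O(\<lambda>n. 1 / (real n)\<^sup>2)"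
proof (rule bigoI[where c = "2 * exp 1"])
  show "eventually (\<lambda>n. norm (exp_sum n - exp 1) \<le> 2 * exp 1 * norm (1 / (real n)\<^sup>2)) sequentially"
    using eventually_ge_at_top[of 2]
  proof eventually_elim
    case (elim n)
    define k where "k = n - 2"
    have n: "n = Suc (Suc k)" using elim by (simp add: k_def)
    have "(real n)\<^sup>2 \<le> 2 * (real n * real (Suc k))" by (simp add: n power2_eq_square algebra_simps)
    also have "\<dots> \<le> 2 * (real n * (real (Suc k) * fact k))"
      using fact_ge_1[of k, where 'a = real] by (intro mult_left_mono) (auto simp: mult_le_cancel_left1)
    also have "real n * (real (Suc k) * fact k) = fact n" by (simp add: n)
    finally have "(real n)\<^sup>2 / 2 \<le> fact n" by simp
    then have "exp 1 / fact n \<le> exp 1 / ((real n)\<^sup>2 / 2)"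
      using elim by (intro divide_left_mono) auto
    then show ?case using exp_sum_bounds[of n] by (simp add: mult.commute)
  qed
qed

lemma sum_fact_le: "(\<Sum>i\<le>m. fact i :: real) \<le> 2 * fact m"
proof (induction m)
  case (Suc m)
  show ?case
  \<comment> \<open>The induction step rests on 2 m! <= (m + 1)!, which fails only at m = 0.\<close>
  proof (cases "m = 0")
    case False
    then have "2 * (fact m :: real) \<le> real (Suc m) * fact m" by (intro mult_right_mono) auto
    then have "2 * (fact m :: real) \<le> fact (Suc m)" by simp
    then show ?thesis using Suc.IH unfolding sum.atMost_Suc by linarith
  qed simp
qed simp

text \<open>Reindexed by the number \<open>l = u - i\<close> of vertices left out, so that the terms
  can be compared with (s + u)!/l!.\<close>

lemma weight_eq: "real (weight s u) = (\<Sum>l\<le>u. real (u choose l) * fact (s + u - l)) / fact s"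
proof -
  have "real (weight s u) = (\<Sum>i\<le>u. real (u choose i) * (fact (s + i) / fact s))"
    unfolding weight_def of_nat_sum
    by (intro sum.cong) (simp_all add: binomial_fact)
  also have "\<dots> = (\<Sum>l\<le>u. real (u choose l) * (fact (s + u - l) / fact s))"
    by (rule sum.reindex_bij_witness[of _ "\<lambda>l. u - l" "\<lambda>l. u - l"])
      (auto simp: binomial_symmetric[symmetric])
  finally show ?thesis by (simp add: sum_divide_distrib)
qed

text \<open>Enlarging \<open>u choose l\<close> to \<open>(s + u) choose l\<close> turns each
  summand into (s + u)!/l!, and the truncated series is at most e.\<close>

lemma weight_le: "real (weight s u) \<le> exp 1 * fact (s + u) / fact s"
proof -
  have "(\<Sum>l\<le>u. real (u choose l) * fact (s + u - l)) \<le> (\<Sum>l\<le>u. fact (s + u) * (1 / fact l))"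
  proof (rule sum_mono)
    fix l assume l: "l \<in> {..u}"
    have "real (u choose l) \<le> real ((s + u) choose l)"
      by (simp add: binomial_right_mono)
    also have "\<dots> = fact (s + u) / (fact l * fact (s + u - l))"
      using l by (intro binomial_fact) simp
    finally show "real (u choose l) * fact (s + u - l) \<le> fact (s + u) * (1 / fact l)"
      by (simp add: field_simps)
  qed
  also have "\<dots> = fact (s + u) * exp_sum (Suc u)"
    by (simp add: exp_sum_def lessThan_Suc_atMost sum_distrib_left)
  also have "\<dots> \<le> fact (s + u) * exp 1"
    using exp_sum_bounds(1) by (intro mult_left_mono) auto
  finally show ?thesis
    unfolding weight_eq by (intro divide_right_mono) (simp_all add: mult.commute)
qed

lemma weight_0: "real (weight 0 u) = fact u * exp_sum (Suc u)"
  unfolding weight_eq exp_sum_def lessThan_Suc_atMost sum_distrib_left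
  by (simp add: binomial_fact)

lemma sum_index_div_fact: "(\<Sum>l\<le>u. real l / fact l) = exp_sum u"
proof -
  have "(\<Sum>l\<le>u. real l / fact l) = (\<Sum>l<Suc u. real l / fact l)"
    by (simp add: lessThan_Suc_atMost)
  also have "\<dots> = (\<Sum>l<u. real (Suc l) / fact (Suc l))"
    by (subst sum.lessThan_Suc_shift) simp
  also have "\<dots> = exp_sum u"
    unfolding exp_sum_def by (intro sum.cong) (simp_all add: divide_simps)
  finally show ?thesis .
qed

text \<open>Splitting (u + 1 - l)! = (u + 1 - l) (u - l)! produces terms l/l!, which sum to
  \<open>exp_sum u\<close>. This subtracted series is the source of the -1/n in the expansion of
  this weight.\<close>

lemma weight_1: "real (weight 1 u) = fact u * (real (Suc u) * exp_sum (Suc u) - exp_sum u)"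
proof -
  have "real (u choose l) * fact (1 + u - l) = fact u * (real (Suc u) * (1 / fact l) - real l / fact l)"
    if "l \<le> u" for l
  proof -
    have "1 + u - l = Suc (u - l)" "real (Suc (u - l)) = real (Suc u) - real l" using that by auto
    then have "(fact (1 + u - l) :: real) = (real (Suc u) - real l) * fact (u - l)"
      by (metis fact_Suc of_nat_mult of_nat_fact)
    then have "real (u choose l) * fact (1 + u - l) =
        real (u choose l) * fact (u - l) * (real (Suc u) - real l)"
      by (simp only: mult_ac)
    also have "real (u choose l) * fact (u - l) = fact u / fact l"
      using that by (simp add: binomial_fact)
    finally show ?thesis by (simp add: diff_divide_distrib algebra_simps)
  qed
  then have "real (weight 1 u) =
      (\<Sum>l\<le>u. fact u * (real (Suc u) * (1 / fact l) - real l / fact l))"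
    unfolding weight_eq by simp
  also have "\<dots> = fact u * (real (Suc u) * exp_sum (Suc u) - (\<Sum>l\<le>u. real l / fact l))"
    unfolding exp_sum_def lessThan_Suc_atMost
    by (simp only: sum_subtractf sum_distrib_left[symmetric])
  finally show ?thesis unfolding sum_index_div_fact .
qed

text \<open>Uses (N - l) (N - 1 - l) >= N (N - 1) - 2 N l with N = u + 2, discarding l + l^2. A
  lower bound suffices because \<open>weight_le\<close> has the right leading term from
  above.\<close>

lemma weight_2_ge:
  "fact u / 2 * (real (Suc (Suc u)) * real (Suc u) * exp_sum (Suc u) - 2 * real (Suc (Suc u)) * exp_sum u)
    \<le> real (weight 2 u)"
proof -
  let ?N = "real (Suc (Suc u))"
  have "fact u * (?N * real (Suc u) * (1 / fact l) - 2 * ?N * (real l / fact l)) \<le>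
      real (u choose l) * fact (2 + u - l)" if "l \<le> u" for l
  proof -
    have N: "2 + u - l = Suc (Suc (u - l))" using that by simp
    have "(fact (2 + u - l) :: real) = (?N - real l) * (real (Suc u) - real l) * fact (u - l)"
      unfolding N fact_Suc using that by (simp add: of_nat_diff algebra_simps)
    then have eq: "real (u choose l) * fact (2 + u - l) =
        fact u / fact l * ((?N - real l) * (real (Suc u) - real l))"
      using that by (simp add: binomial_fact)
    have "?N * real (Suc u) - 2 * ?N * real l \<le> (?N - real l) * (real (Suc u) - real l)"
      by (simp add: algebra_simps)
    then have "fact u / fact l * (?N * real (Suc u) - 2 * ?N * real l) \<le>
        fact u / fact l * ((?N - real l) * (real (Suc u) - real l))"
      by (intro mult_left_mono) auto
    then show ?thesis unfolding eq by (simp add: algebra_simps)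
  qed
  then have "(\<Sum>l\<le>u. fact u * (?N * real (Suc u) * (1 / fact l) - 2 * ?N * (real l / fact l))) \<le>
      (\<Sum>l\<le>u. real (u choose l) * fact (2 + u - l))"
    by (intro sum_mono) auto
  also have "(\<Sum>l\<le>u. fact u * (?N * real (Suc u) * (1 / fact l) - 2 * ?N * (real l / fact l))) =
      fact u * (?N * real (Suc u) * exp_sum (Suc u) - 2 * ?N * (\<Sum>l\<le>u. real l / fact l))"
    unfolding exp_sum_def lessThan_Suc_atMost
    by (simp only: sum_subtractf sum_distrib_left[symmetric])
  finally show ?thesis unfolding weight_eq sum_index_div_fact by (simp add: fact_numeral)
qed

section \<open>Domination by one-source graphs\<close>

definition code_count :: "nat \<Rightarrow> nat \<Rightarrow> real" where
  "code_count n k = real (card (codes n k))"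

text \<open>Graphs with at least \<open>j\<close> sources, since there are never more sources than
  vertices; \<open>j = 0\<close> gives \<open>D n\<close>.\<close>

definition tail_count :: "nat \<Rightarrow> nat \<Rightarrow> real" where
  "tail_count j n = (\<Sum>k=j..n. code_count n k)"

lemma code_count_nonneg: "0 \<le> code_count n k"
  by (simp add: code_count_def)

lemma tail_count_nonneg: "0 \<le> tail_count j n"
  by (simp add: tail_count_def sum_nonneg code_count_nonneg)

lemma code_count_Suc_Suc:
  assumes "k \<le> n"
  shows "code_count (Suc n) (Suc k) = (\<Sum>s\<le>n - k. code_count n (k + s) * real (weight s (n - k - s)))"
  unfolding code_count_def using card_codes_Suc[OF assms] by simp

text \<open>Since s + (n - k - s) = n - k, dropping the factor 1/s! from \<open>weight_le\<close>
  bounds all weights by the same e (n - k)!.\<close>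

lemma partial_sum_le_tail_count:
  assumes "k \<le> n"
  shows "(\<Sum>s=i..n - k. code_count n (k + s) * real (weight s (n - k - s))) \<le>
    exp 1 * fact (n - k) * tail_count (k + i) n"
proof -
  have "(\<Sum>s=i..n - k. code_count n (k + s) * real (weight s (n - k - s))) \<le>
      (\<Sum>s=i..n - k. code_count n (k + s) * (exp 1 * fact (n - k)))"
  proof (intro sum_mono mult_left_mono code_count_nonneg)
    fix s assume s: "s \<in> {i..n - k}"
    have "s \<le> n - k" using s by simp
    then have "s + (n - k - s) = n - k" by (rule le_add_diff_inverse)
    then have "real (weight s (n - k - s)) \<le> exp 1 * fact (n - k) / fact s"
      using weight_le[of s "n - k - s"] by (simp only:)
    also have "\<dots> \<le> exp 1 * fact (n - k) / 1"
      by (intro divide_left_mono) (auto simp: fact_ge_1)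
    finally show "real (weight s (n - k - s)) \<le> exp 1 * fact (n - k)" by simp
  qed
  also have "\<dots> = exp 1 * fact (n - k) * (\<Sum>s=i..n - k. code_count n (k + s))"
    by (simp add: sum_distrib_left mult.commute)
  also have "(\<Sum>s=i..n - k. code_count n (k + s)) = tail_count (k + i) n"
    unfolding tail_count_def using assms
    by (intro sum.reindex_bij_witness[of _ "\<lambda>j. j - k" "\<lambda>s. k + s"]) auto
  finally show ?thesis .
qed


lemma code_count_Suc_0: "code_count (Suc n) 0 = 0"
  by (simp add: code_count_def codes_Suc_0)

lemma code_count_1_1: "code_count 1 1 = 1"
  using codes_0_1 by (simp add: code_count_def)

lemma code_count_Suc_Suc_le:
  assumes "k \<le> n"
  shows "code_count (Suc n) (Suc k) \<le> exp 1 * fact (n - k) * tail_count 0 n"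
proof -
  have "code_count (Suc n) (Suc k) \<le> exp 1 * fact (n - k) * tail_count k n"
    using partial_sum_le_tail_count[OF assms, of 0] code_count_Suc_Suc[OF assms] by (simp add: atMost_atLeast0)
  also have "tail_count k n \<le> tail_count 0 n"
    unfolding tail_count_def by (intro sum_mono2) (auto simp: code_count_nonneg)
  finally show ?thesis by (simp add: mult_left_mono)
qed

text \<open>The factorials fall so fast that their sum is at most twice the first term, so requiring
  one more source divides the bound by \<open>n - j\<close>.\<close>

lemma tail_count_Suc_Suc_le:
  assumes "j \<le> n"
  shows "tail_count (Suc j) (Suc n) \<le> 2 * exp 1 * fact (n - j) * tail_count 0 n"
proof -
  have "tail_count (Suc j) (Suc n) = (\<Sum>k=j..n. code_count (Suc n) (Suc k))"
    unfolding tail_count_def by (rule sum.shift_bounds_cl_Suc_ivl)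
  also have "\<dots> \<le> (\<Sum>k=j..n. exp 1 * tail_count 0 n * fact (n - k))"
    using code_count_Suc_Suc_le[where n = n] by (intro sum_mono) (auto simp: mult_ac)
  also have "\<dots> = exp 1 * tail_count 0 n * (\<Sum>k=j..n. fact (n - k))"
    by (simp add: sum_distrib_left)
  also have "(\<Sum>k=j..n. fact (n - k) :: real) = (\<Sum>i\<le>n - j. fact i)"
    using assms by (intro sum.reindex_bij_witness[of _ "\<lambda>i. n - i" "\<lambda>k. n - k"]) auto
  also have "exp 1 * tail_count 0 n * \<dots> \<le> exp 1 * tail_count 0 n * (2 * fact (n - j))"
    by (intro mult_left_mono sum_fact_le mult_nonneg_nonneg tail_count_nonneg) simp
  finally show ?thesis by (simp add: mult_ac)
qed

lemma tail_count_split: "j \<le> n \<Longrightarrow> tail_count j n = code_count n j + tail_count (Suc j) n"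
  unfolding tail_count_def by (rule sum.atLeast_Suc_atMost)

lemma tail_count_0_eq: "1 \<le> n \<Longrightarrow> tail_count 0 n = code_count n 1 + tail_count 2 n"
  using tail_count_split[of 0 n] tail_count_split[of 1 n] code_count_Suc_0[of "n - 1"] by (simp add: numeral_2_eq_2)

lemma tail_count_0_eq_D: "tail_count 0 n = real (D n)"
  by (simp add: tail_count_def code_count_def D_eq atMost_atLeast0)

lemma code_count_1_eq_D_star: "code_count n 1 = real (D_star n)"
  unfolding code_count_def D_star_eq ..

text \<open>Remainders with one or two sources are kept exactly; those with three or more will turn
  out to be of relative order 1/n^2.\<close>

lemma code_count_Suc_1_bounds:
  assumes "2 \<le> n"
  defines "main \<equiv> code_count n 1 * real (weight 1 (n - 1)) + code_count n 2 * real (weight 2 (n - 2))"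
  shows "main \<le> code_count (Suc n) 1" "code_count (Suc n) 1 \<le> main + exp 1 * fact n * tail_count 3 n"
proof -
  let ?f = "\<lambda>s. code_count n (0 + s) * real (weight s (n - 0 - s))"
  have "code_count (Suc n) 1 = sum ?f {0..n}"
    using code_count_Suc_Suc[of 0 n] by (simp add: atMost_atLeast0)
  also have "\<dots> = ?f 0 + (?f 1 + (?f 2 + sum ?f {3..n}))"
    using assms(1) by (simp add: sum.atLeast_Suc_atMost numeral_2_eq_2 numeral_3_eq_3)
  \<comment> \<open>A nonempty remainder has at least one source.\<close>
  also have "?f 0 = 0" using code_count_Suc_0[of "n - 1"] assms(1) by simp
  finally have eq: "code_count (Suc n) 1 = main + sum ?f {3..n}" by (simp add: main_def numeral_2_eq_2)
  show "main \<le> code_count (Suc n) 1"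
    unfolding eq by (simp add: sum_nonneg code_count_nonneg)
  show "code_count (Suc n) 1 \<le> main + exp 1 * fact n * tail_count 3 n"
    unfolding eq using partial_sum_le_tail_count[of 0 n 3] by simp
qed

text \<open>Only one-source remainders are kept: the count is itself smaller by a factor of order n,
  so a relative error O(1/n) is affordable.\<close>

lemma code_count_Suc_2_bounds:
  assumes "1 \<le> n"
  defines "main \<equiv> code_count n 1 * real (weight 0 (n - 1))"
  shows "main \<le> code_count (Suc n) 2" "code_count (Suc n) 2 \<le> main + exp 1 * fact (n - 1) * tail_count 2 n"
proof -
  let ?f = "\<lambda>s. code_count n (1 + s) * real (weight s (n - 1 - s))"
  have "code_count (Suc n) 2 = sum ?f {0..n - 1}"
    using code_count_Suc_Suc[OF assms(1)] by (simp add: atMost_atLeast0 numeral_2_eq_2)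
  also have "\<dots> = ?f 0 + sum ?f {1..n - 1}"
    by (simp add: sum.atLeast_Suc_atMost)
  finally have eq: "code_count (Suc n) 2 = main + sum ?f {1..n - 1}" by (simp add: main_def)
  show "main \<le> code_count (Suc n) 2"
    unfolding eq by (simp add: sum_nonneg code_count_nonneg)
  show "code_count (Suc n) 2 \<le> main + exp 1 * fact (n - 1) * tail_count 2 n"
    unfolding eq using partial_sum_le_tail_count[OF assms(1), of 1] by (simp add: numeral_2_eq_2)
qed

text \<open>Keep only the rows that list every vertex, the term \<open>i = u\<close>: there are u!
  (u + 1) of them.\<close>

lemma fact_le_weight_1: "fact (Suc u) \<le> real (weight 1 u)"
proof -
  have "weight 1 u \<ge> (u choose u) * fact u * ((1 + u) choose 1)"
    unfolding weight_def by (rule member_le_sum) auto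
  then have "fact (Suc u) \<le> weight 1 u" by (simp add: algebra_simps)
  then show ?thesis by (metis of_nat_fact of_nat_le_iff)
qed

text \<open>Loses a constant factor against the true growth e n!, but already suffices to make the
  counts with more sources comparatively small.\<close>

lemma code_count_Suc_1_ge:
  assumes "1 \<le> n"
  shows "fact n * code_count n 1 \<le> code_count (Suc n) 1"
proof -
  have "code_count n (0 + 1) * real (weight 1 (n - 0 - 1)) \<le> code_count (Suc n) (Suc 0)"
    unfolding code_count_Suc_Suc[OF le0] using assms by (intro member_le_sum) (auto simp: code_count_nonneg)
  moreover have "fact n * code_count n 1 \<le> code_count n 1 * real (weight 1 (n - 1))"
    using fact_le_weight_1[of "n - 1"] assms
    by (subst mult.commute) (intro mult_left_mono code_count_nonneg, simp)
  ultimately show ?thesis by simp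
qed

lemma code_count_1_pos:
  assumes "1 \<le> n"
  shows "0 < code_count n 1"
  using assms
proof (induction n rule: dec_induct)
  case base
  show ?case using code_count_1_1 by simp
next
  case (step n)
  have "0 < fact n * code_count n 1" using step.IH by simp
  also have "\<dots> \<le> code_count (Suc n) 1" using code_count_Suc_1_ge step.hyps by simp
  finally show ?case .
qed

text \<open>The upper bound for several sources grows by (n - 1)!, the one-source count by at least
  n!; the quotient is the gain 1/n.\<close>

lemma tail_count_2_Suc_le:
  assumes "1 \<le> n" "tail_count 0 n \<le> K * code_count n 1" "0 \<le> K"
  shows "tail_count 2 (Suc n) \<le> 2 * exp 1 * K / real n * code_count (Suc n) 1"
proof -
  have "tail_count 2 (Suc n) \<le> 2 * exp 1 * fact (n - 1) * tail_count 0 n"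
    using tail_count_Suc_Suc_le[OF assms(1)] by (simp add: numeral_2_eq_2)
  also have "\<dots> \<le> 2 * exp 1 * fact (n - 1) * (K * code_count n 1)"
    using assms(2) by (intro mult_left_mono) auto
  also have "\<dots> = 2 * exp 1 * K / real n * (fact n * code_count n 1)"
    using assms(1) by (simp add: fact_reduce)
  also have "\<dots> \<le> 2 * exp 1 * K / real n * code_count (Suc n) 1"
    using code_count_Suc_1_ge[OF assms(1)] assms(3) by (intro mult_left_mono) auto
  finally show ?thesis .
qed

lemma tail_count_3_Suc_le:
  assumes "2 \<le> n" "tail_count 0 n \<le> K * code_count n 1" "0 \<le> K"
  shows "tail_count 3 (Suc n) \<le> 2 * exp 1 * K / (real n * (real n - 1)) * code_count (Suc n) 1"
proof -
  have "tail_count 3 (Suc n) \<le> 2 * exp 1 * fact (n - 2) * tail_count 0 n"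
    using tail_count_Suc_Suc_le[OF assms(1)] by (simp add: numeral_3_eq_3 numeral_2_eq_2)
  also have "\<dots> \<le> 2 * exp 1 * fact (n - 2) * (K * code_count n 1)"
    using assms(2) by (intro mult_left_mono) auto
  also have "\<dots> = 2 * exp 1 * K / (real n * (real n - 1)) * (fact n * code_count n 1)"
  proof -
    obtain m where "n = Suc (Suc m)" using assms(1) by (metis add_2_eq_Suc le_Suc_ex)
    then show ?thesis by (simp add: divide_simps)
  qed
  also have "\<dots> \<le> 2 * exp 1 * K / (real n * (real n - 1)) * code_count (Suc n) 1"
    using code_count_Suc_1_ge[of n] assms(1,3) by (intro mult_left_mono) auto
  finally show ?thesis .
qed

text \<open>Closes the circle of \<open>tail_count_2_Suc_le\<close>: the bound with \<open>K\<close>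
  at \<open>n\<close> leaves so few graphs with several sources at \<open>n + 1\<close> that the
  same \<open>K\<close> works again.\<close>

lemma total_le_multiple_of_one_source:
  "\<exists>K \<ge> 0. \<forall>n \<ge> 12. tail_count 0 n \<le> K * code_count n 1"
proof -
  \<comment> \<open>The entry 2 makes 1 + K/2 <= K in the induction step; the other entry is the
    base case.\<close>
  define K where "K = max 2 (tail_count 0 12 / code_count 12 1)"
  have "tail_count 0 n \<le> K * code_count n 1" if "n \<ge> 12" for n
    using that
  proof (induction n rule: dec_induct)
    case base
    have "tail_count 0 12 = tail_count 0 12 / code_count 12 1 * code_count 12 1" using code_count_1_pos[of 12] by simp
    also have "\<dots> \<le> K * code_count 12 1"
      unfolding K_def by (intro mult_right_mono code_count_nonneg) simp
    finally show ?case .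
  next
    case (step n)
    have K: "2 \<le> K" by (simp add: K_def)
    \<comment> \<open>As e <= 3, the starting index 12 brings this factor down to K/2.\<close>
    have "2 * exp 1 * K / real n \<le> 6 * K / 12"
      using step.hyps K exp_le by (intro frac_le mult_right_mono) auto
    then have "2 * exp 1 * K / real n * code_count (Suc n) 1 \<le> K / 2 * code_count (Suc n) 1"
      by (intro mult_right_mono code_count_nonneg) simp
    moreover have "tail_count 2 (Suc n) \<le> 2 * exp 1 * K / real n * code_count (Suc n) 1"
      using tail_count_2_Suc_le[OF _ step.IH] step.hyps K by simp
    moreover have "tail_count 0 (Suc n) = code_count (Suc n) 1 + tail_count 2 (Suc n)" by (simp add: tail_count_0_eq)
    ultimately have "tail_count 0 (Suc n) \<le> 1 * code_count (Suc n) 1 + K / 2 * code_count (Suc n) 1" by linarith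
    also have "\<dots> = (1 + K / 2) * code_count (Suc n) 1" by (simp only: distrib_right)
    also have "\<dots> \<le> K * code_count (Suc n) 1"
      using K by (intro mult_right_mono code_count_nonneg) simp
    finally show ?case .
  qed
  then show ?thesis by (intro exI[of _ K]) (auto simp: K_def)
qed

text \<open>The recurrences estimate quantities at \<open>n + 1\<close>; this moves the estimates
  back to \<open>n\<close>.\<close>

lemma bigo_SucD:
  fixes f g :: "nat \<Rightarrow> real"
  assumes "(\<lambda>n. f (Suc n)) \<in> O(\<lambda>n. g (Suc n))"
  shows "f \<in> O(g)"
  using assms unfolding bigo_def mem_Collect_eq
  by (subst (asm) eventually_sequentially_Suc)

lemma tail_count_2_ratio: "(\<lambda>n. tail_count 2 n / code_count n 1) \<in> O(\<lambda>n. 1 / real n)"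
proof (rule bigo_SucD)
  obtain K where K: "0 \<le> K" "\<And>n. n \<ge> 12 \<Longrightarrow> tail_count 0 n \<le> K * code_count n 1"
    using total_le_multiple_of_one_source by blast
  have "eventually (\<lambda>n. norm (tail_count 2 (Suc n) / code_count (Suc n) 1) \<le> (2 * exp 1 * K) * norm (1 / real n))
      sequentially"
    using eventually_ge_at_top[of 12]
  proof eventually_elim
    case (elim n)
    then show ?case
      using tail_count_2_Suc_le[OF _ K(2)[OF elim] K(1)] code_count_1_pos[of "Suc n"] tail_count_nonneg[of 2 "Suc n"]
      by (simp add: pos_divide_le_eq)
  qed
  then have "(\<lambda>n. tail_count 2 (Suc n) / code_count (Suc n) 1) \<in> O(\<lambda>n. 1 / real n)" by (rule bigoI)
  also have "(\<lambda>n. 1 / real n) \<in> O(\<lambda>n. 1 / real (Suc n))" by real_asymp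
  finally show "(\<lambda>n. tail_count 2 (Suc n) / code_count (Suc n) 1) \<in> O(\<lambda>n. 1 / real (Suc n))" .
qed

lemma tail_count_3_ratio: "(\<lambda>n. tail_count 3 n / code_count n 1) \<in> O(\<lambda>n. 1 / (real n)\<^sup>2)"
proof (rule bigo_SucD)
  obtain K where K: "0 \<le> K" "\<And>n. n \<ge> 12 \<Longrightarrow> tail_count 0 n \<le> K * code_count n 1"
    using total_le_multiple_of_one_source by blast
  have "eventually (\<lambda>n. norm (tail_count 3 (Suc n) / code_count (Suc n) 1) \<le>
      (2 * exp 1 * K) * norm (1 / (real n * (real n - 1)))) sequentially"
    using eventually_ge_at_top[of 12]
  proof eventually_elim
    case (elim n)
    then show ?case
      using tail_count_3_Suc_le[OF _ K(2)[OF elim] K(1)] code_count_1_pos[of "Suc n"] tail_count_nonneg[of 3 "Suc n"]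
      by (simp add: pos_divide_le_eq)
  qed
  then have "(\<lambda>n. tail_count 3 (Suc n) / code_count (Suc n) 1) \<in> O(\<lambda>n. 1 / (real n * (real n - 1)))"
    by (rule bigoI)
  also have "(\<lambda>n. 1 / (real n * (real n - 1))) \<in> O(\<lambda>n. 1 / (real (Suc n))\<^sup>2)" by real_asymp
  finally show "(\<lambda>n. tail_count 3 (Suc n) / code_count (Suc n) 1) \<in> O(\<lambda>n. 1 / (real (Suc n))\<^sup>2)" .
qed


section \<open>Expansions of the weights and of the ratio\<close>

lemma exp_sum_pred_asymp: "(\<lambda>n. exp_sum (n - 1) - exp 1) \<in> O(\<lambda>n. 1 / real n)"
proof (rule bigo_SucD)
  have "(\<lambda>n. exp_sum n - exp 1) \<in> O(\<lambda>n. 1 / (real n)\<^sup>2)" by (rule exp_sum_asymp)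
  also have "(\<lambda>n. 1 / (real n)\<^sup>2) \<in> O(\<lambda>n. 1 / real (Suc n))" by real_asymp
  finally show "(\<lambda>n. exp_sum (Suc n - 1) - exp 1) \<in> O(\<lambda>n. 1 / real (Suc n))" by simp
qed

lemma weight_0_asymp: "(\<lambda>n. real (weight 0 (n - 1)) / fact (n - 1) - exp 1) \<in> O(\<lambda>n. 1 / real n)"
proof (rule bigo_SucD)
  have "(\<lambda>n. exp_sum (Suc n) - exp 1) \<in> O(\<lambda>n. 1 / (real (Suc n))\<^sup>2)"
    by (rule landau_o.big.compose[OF exp_sum_asymp filterlim_Suc])
  also have "(\<lambda>n. 1 / (real (Suc n))\<^sup>2) \<in> O(\<lambda>n. 1 / real (Suc n))" by real_asymp
  finally show "(\<lambda>n. real (weight 0 (Suc n - 1)) / fact (Suc n - 1) - exp 1) \<in> O(\<lambda>n. 1 / real (Suc n))"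
    by (simp add: weight_0)
qed

text \<open>The quotient is \<open>exp_sum n - exp_sum (n - 1) / real n\<close>: the first series is
  needed up to O(1/n^2), the second, already divided by n, only up to O(1/n).\<close>

lemma weight_1_asymp:
  "(\<lambda>n. real (weight 1 (n - 1)) / fact n - exp 1 * (1 - 1 / real n)) \<in> O(\<lambda>n. 1 / (real n)\<^sup>2)"
proof -
  have "(\<lambda>n. (exp_sum (n - 1) - exp 1) * (1 / real n)) \<in> O(\<lambda>n. 1 / real n * (1 / real n))"
    by (rule landau_o.big.mult[OF exp_sum_pred_asymp landau_o.big_refl])
  then have "(\<lambda>n. (exp_sum (n - 1) - exp 1) * (1 / real n)) \<in> O(\<lambda>n. 1 / (real n)\<^sup>2)"
    by (simp add: power2_eq_square)
  with exp_sum_asymp have "(\<lambda>n. (exp_sum n - exp 1) - (exp_sum (n - 1) - exp 1) * (1 / real n))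
      \<in> O(\<lambda>n. 1 / (real n)\<^sup>2)"
    by (rule sum_in_bigo(2))
  moreover have "eventually (\<lambda>n. (exp_sum n - exp 1) - (exp_sum (n - 1) - exp 1) * (1 / real n) =
      real (weight 1 (n - 1)) / fact n - exp 1 * (1 - 1 / real n)) sequentially"
    using eventually_ge_at_top[of 1]
  proof eventually_elim
    case (elim n)
    then obtain m where n: "n = Suc m" by (cases n) auto
    have "real (weight 1 (n - 1)) / fact n = exp_sum n - exp_sum (n - 1) / real n"
      unfolding n diff_Suc_1 weight_1 fact_Suc by (simp add: field_simps del: of_nat_Suc)
    then show ?case by (simp add: algebra_simps diff_divide_distrib)
  qed
  ultimately show ?thesis using landau_o.big.in_cong by fastforce
qed

text \<open>The bound e/2 from above is exact, so only the deficit is estimated. Order 1/n is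
  enough, since this weight gets multiplied by the share of two-source graphs.\<close>

lemma weight_2_asymp:
  "(\<lambda>n. real (weight 2 (n - 2)) / fact n - exp 1 / 2) \<in> O(\<lambda>n. 1 / real n)"
proof -
  have "(\<lambda>n. real (weight 2 (n - 2)) / fact n - exp 1 / 2) \<in>
      O(\<lambda>n. norm (exp_sum (n - 1) - exp 1) + exp 1 / (real n - 1))"
  proof (rule bigoI[where c = 1])
    show "eventually (\<lambda>n. norm (real (weight 2 (n - 2)) / fact n - exp 1 / 2) \<le>
        1 * norm (norm (exp_sum (n - 1) - exp 1) + exp 1 / (real n - 1))) sequentially"
      using eventually_ge_at_top[of 2]
    proof eventually_elim
      case (elim n)
      then obtain u where n: "n = Suc (Suc u)" by (metis add_2_eq_Suc le_Suc_ex)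
      have "real (weight 2 u) \<le> exp 1 * fact n / 2"
        using weight_le[of 2 u] by (simp add: n fact_numeral)
      then have upper: "real (weight 2 u) / fact n \<le> exp 1 / 2"
        by (simp add: divide_le_eq)
      have "exp_sum (Suc u) / 2 - exp_sum u / real (Suc u) =
          fact u / 2 * (real (Suc (Suc u)) * real (Suc u) * exp_sum (Suc u)
            - 2 * real (Suc (Suc u)) * exp_sum u) / fact n"
        unfolding n fact_Suc by (simp add: divide_simps del: of_nat_Suc) (simp add: algebra_simps del: of_nat_Suc)
      also have "\<dots> \<le> real (weight 2 u) / fact n"
        by (intro divide_right_mono weight_2_ge) simp
      finally have "exp_sum (Suc u) / 2 - exp_sum u / real (Suc u) \<le> real (weight 2 u) / fact n" .
      moreover have "exp_sum u / real (Suc u) \<le> exp 1 / real (Suc u)"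
        by (intro divide_right_mono exp_sum_bounds(1)) simp
      ultimately have "exp 1 / 2 - real (weight 2 u) / fact n \<le>
          (exp 1 - exp_sum (Suc u)) + exp 1 / real (Suc u)"
        using exp_sum_bounds(1)[of "Suc u"] by linarith
      moreover have "norm (real (weight 2 u) / fact n - exp 1 / 2) =
          exp 1 / 2 - real (weight 2 u) / fact n"
        using upper by simp
      moreover have "norm (exp_sum (Suc u) - exp 1) = exp 1 - exp_sum (Suc u)"
        using exp_sum_bounds(1)[of "Suc u"] by simp
      moreover have "real n - 1 = real (Suc u)" "n - 1 = Suc u" "n - 2 = u" by (simp_all add: n)
      ultimately show ?case by simp
    qed
  qed
  also have "(\<lambda>n. norm (exp_sum (n - 1) - exp 1) + exp 1 / (real n - 1)) \<in> O(\<lambda>n. 1 / real n)"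
  proof (rule sum_in_bigo(1))
    show "(\<lambda>n. norm (exp_sum (n - 1) - exp 1)) \<in> O(\<lambda>n. 1 / real n)"
      using exp_sum_pred_asymp by simp
    show "(\<lambda>n. exp 1 / (real n - 1)) \<in> O(\<lambda>n. 1 / real n)" by real_asymp
  qed
  finally show ?thesis .
qed

text \<open>The factor \<open>g\<close> is bounded because it converges to \<open>c\<close>.\<close>

lemma bigo_mult_const:
  fixes f g h :: "nat \<Rightarrow> real"
  assumes "f \<in> O(h)" "(\<lambda>n. g n - c) \<in> O(\<lambda>n. 1 / real n)"
  shows "(\<lambda>n. f n * g n) \<in> O(h)"
proof -
  have "(\<lambda>n. g n - c) \<in> O(\<lambda>n. 1)"
    using assms(2) by (rule landau_o.big_trans) real_asymp
  then have "(\<lambda>n. (g n - c) + c) \<in> O(\<lambda>n. 1)" by (rule sum_in_bigo(1)) simp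
  then show ?thesis using landau_o.big.mult[OF assms(1), of g "\<lambda>n. 1"] by simp
qed

text \<open>Each vertex contributes a factor \<open>e n! (1 - 1/(2 n) + O(1/n\<^sup>2))\<close>: passing through graphs
  with one source gives \<open>1 - 1/n\<close>, and passing through graphs with two sources adds \<open>1/(2 n)\<close>.\<close>

lemma one_source_ratio:
  "(\<lambda>n. code_count (Suc n) 1 / (fact n * code_count n 1) - exp 1 * (1 - 1 / (2 * real n))) \<in> O(\<lambda>n. 1 / (real n)\<^sup>2)"
proof -
  define \<rho> where "\<rho> n = code_count (Suc n) 1 / (fact n * code_count n 1)" for n
  define \<beta> where "\<beta> n = code_count n 2 / code_count n 1" for n
  define w1 where "w1 n = real (weight 1 (n - 1)) / fact n" for n
  define w2 where "w2 n = real (weight 2 (n - 2)) / fact n" for n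
  define w0 where "w0 n = real (weight 0 (n - 1)) / fact (n - 1)" for n
  \<comment> \<open>The relative contribution of remainders with three or more sources.\<close>
  define r where "r n = \<rho> n - (w1 n + \<beta> n * w2 n)" for n
  \<comment> \<open>The product equals \<open>code_count (Suc n) 2\<close> over (n - 1)!
    \<open>code_count n 1\<close>, so \<open>q\<close> is what remains of the two-source recurrence
    after removing the one-source remainders.\<close>
  define q where "q n = real n * \<rho> n * \<beta> (Suc n) - w0 n" for n
  have one: "(\<lambda>n. 1 / (real n)\<^sup>2) \<in> O(\<lambda>n. 1 / real n)" by real_asymp
  have r: "r \<in> O(\<lambda>n. 1 / (real n)\<^sup>2)"
  proof -
    have "r \<in> O(\<lambda>n. tail_count 3 n / code_count n 1)"
    proof (rule bigoI[where c = "exp 1"])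
      show "eventually (\<lambda>n. norm (r n) \<le> exp 1 * norm (tail_count 3 n / code_count n 1)) sequentially"
        using eventually_ge_at_top[of 2]
      proof eventually_elim
        case (elim n)
        have pos: "0 < code_count n 1" using code_count_1_pos elim by simp
        define m where "m = code_count n 1 * real (weight 1 (n - 1)) + code_count n 2 * real (weight 2 (n - 2))"
        have "r n = (code_count (Suc n) 1 - m) / (fact n * code_count n 1)"
          using pos unfolding r_def \<rho>_def w1_def \<beta>_def w2_def m_def
          by (simp add: field_simps)
        moreover have "0 \<le> code_count (Suc n) 1 - m" "code_count (Suc n) 1 - m \<le> exp 1 * fact n * tail_count 3 n"
          using code_count_Suc_1_bounds[OF elim] by (simp_all add: m_def)
        ultimately have "0 \<le> r n" "r n \<le> exp 1 * fact n * tail_count 3 n / (fact n * code_count n 1)"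
          using pos by (simp, metis divide_right_mono fact_ge_zero less_imp_le mult_nonneg_nonneg)
        then show ?case using pos tail_count_nonneg[of 3 n] by simp
      qed
    qed
    then show ?thesis using tail_count_3_ratio by (rule landau_o.big_trans)
  qed
  have \<beta>1: "\<beta> \<in> O(\<lambda>n. 1 / real n)"
  proof -
    have "\<beta> \<in> O(\<lambda>n. tail_count 2 n / code_count n 1)"
    proof (rule bigoI[where c = 1])
      show "eventually (\<lambda>n. norm (\<beta> n) \<le> 1 * norm (tail_count 2 n / code_count n 1)) sequentially"
        using eventually_ge_at_top[of 2]
      proof eventually_elim
        case (elim n)
        have "code_count n 2 \<le> tail_count 2 n" using tail_count_split[OF elim] tail_count_nonneg[of 3 n] by simp
        then show ?case
          using code_count_nonneg[of n 1] code_count_nonneg[of n 2] tail_count_nonneg[of 2 n]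
          by (auto simp: \<beta>_def intro!: divide_right_mono)
      qed
    qed
    then show ?thesis using tail_count_2_ratio by (rule landau_o.big_trans)
  qed
  \<comment> \<open>First approximation, using only that the share \<open>\<beta>\<close> is O(1/n);
    it is fed back to sharpen \<open>\<beta>\<close>.\<close>
  have \<rho>1: "(\<lambda>n. \<rho> n - exp 1) \<in> O(\<lambda>n. 1 / real n)"
  proof -
    have "(\<lambda>n. w1 n - exp 1 * (1 - 1 / real n)) \<in> O(\<lambda>n. 1 / real n)"
      using weight_1_asymp one unfolding w1_def by (rule landau_o.big_trans)
    moreover have "(\<lambda>n. - exp 1 / real n) \<in> O(\<lambda>n. 1 / real n)" by real_asymp
    moreover have "(\<lambda>n. \<beta> n * w2 n) \<in> O(\<lambda>n. 1 / real n)"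
      using \<beta>1 weight_2_asymp unfolding w2_def by (rule bigo_mult_const)
    moreover have "r \<in> O(\<lambda>n. 1 / real n)" using r one by (rule landau_o.big_trans)
    ultimately have "(\<lambda>n. (w1 n - exp 1 * (1 - 1 / real n)) + - exp 1 / real n + \<beta> n * w2 n + r n)
        \<in> O(\<lambda>n. 1 / real n)"
      by (intro sum_in_bigo(1))
    then show ?thesis by (simp add: r_def algebra_simps)
  qed
  have q: "q \<in> O(\<lambda>n. 1 / real n)"
  proof -
    have "q \<in> O(\<lambda>n. tail_count 2 n / code_count n 1)"
    proof (rule bigoI[where c = "exp 1"])
      show "eventually (\<lambda>n. norm (q n) \<le> exp 1 * norm (tail_count 2 n / code_count n 1)) sequentially"
        using eventually_ge_at_top[of 1]
      proof eventually_elim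
        case (elim n)
        have pos: "0 < code_count n 1" "0 < code_count (Suc n) 1" using code_count_1_pos elim by auto
        define m where "m = code_count n 1 * real (weight 0 (n - 1))"
        have n: "(fact n :: real) = real n * fact (n - 1)" using elim by (simp add: fact_reduce)
        have "q n = (code_count (Suc n) 2 - m) / (fact (n - 1) * code_count n 1)"
          using pos elim unfolding q_def \<rho>_def w0_def \<beta>_def m_def n
          by (simp add: field_simps)
        moreover have "0 \<le> code_count (Suc n) 2 - m" "code_count (Suc n) 2 - m \<le> exp 1 * fact (n - 1) * tail_count 2 n"
          using code_count_Suc_2_bounds[OF elim] by (simp_all add: m_def)
        ultimately have "0 \<le> q n" "q n \<le> exp 1 * fact (n - 1) * tail_count 2 n / (fact (n - 1) * code_count n 1)"
          using pos by (simp, metis divide_right_mono fact_ge_zero less_imp_le mult_nonneg_nonneg)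
        then show ?case using pos tail_count_nonneg[of 2 n] by simp
      qed
    qed
    then show ?thesis using tail_count_2_ratio by (rule landau_o.big_trans)
  qed
  have \<rho>_lim: "\<rho> \<longlonglongrightarrow> exp 1"
  proof -
    have "(\<lambda>n. \<rho> n - exp 1) \<in> o(\<lambda>n. 1)"
      using \<rho>1 by (rule landau_o.big_small_trans) real_asymp
    then have "(\<lambda>n. \<rho> n - exp 1) \<longlonglongrightarrow> 0" by (rule smalloD_tendsto[THEN tendsto_cong[THEN iffD1, rotated]]) simp
    then show ?thesis by (simp add: LIM_zero_iff)
  qed
  have inv: "(\<lambda>n. 1 / \<rho> n) \<in> O(\<lambda>n. 1)"
    by (rule bigoI_tendsto[where c = "1 / exp 1"]) (auto intro!: tendsto_intros \<rho>_lim)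
  have \<beta>2: "(\<lambda>n. \<beta> n - 1 / real n) \<in> O(\<lambda>n. 1 / (real n)\<^sup>2)"
  proof (rule bigo_SucD)
    \<comment> \<open>Both \<open>w0\<close> and \<open>\<rho>\<close> tend to e, so their limits
      cancel in n \<open>\<rho> n\<close> \<open>\<beta> (Suc n)\<close> - \<open>\<rho> n\<close>,
      which is therefore O(1/n). Dividing by n \<open>\<rho> n\<close> gives the share up to
      O(1/n^2).\<close>
    have "(\<lambda>n. q n + (w0 n - exp 1) - (\<rho> n - exp 1)) \<in> O(\<lambda>n. 1 / real n)"
      using q weight_0_asymp \<rho>1 unfolding w0_def by (rule sum_in_bigo(2)[OF sum_in_bigo(1)])
    then have "(\<lambda>n. 1 / real n * (1 / \<rho> n * (q n + (w0 n - exp 1) - (\<rho> n - exp 1)))) \<in>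
        O(\<lambda>n. 1 / real n * (1 * (1 / real n)))"
      by (intro landau_o.big.mult inv landau_o.big_refl)
    also have "(\<lambda>n. 1 / real n * (1 * (1 / real n))) \<in> O(\<lambda>n. 1 / (real (Suc n))\<^sup>2)" by real_asymp
    finally have "(\<lambda>n. 1 / real n * (1 / \<rho> n * (q n + (w0 n - exp 1) - (\<rho> n - exp 1)))) \<in>
        O(\<lambda>n. 1 / (real (Suc n))\<^sup>2)" .
    moreover have "(\<lambda>n. 1 / real n - 1 / real (Suc n)) \<in> O(\<lambda>n. 1 / (real (Suc n))\<^sup>2)" by real_asymp
    ultimately have "(\<lambda>n. 1 / real n * (1 / \<rho> n * (q n + (w0 n - exp 1) - (\<rho> n - exp 1))) +
        (1 / real n - 1 / real (Suc n))) \<in> O(\<lambda>n. 1 / (real (Suc n))\<^sup>2)"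
      by (rule sum_in_bigo)
    moreover have "eventually (\<lambda>n. 1 / real n * (1 / \<rho> n * (q n + (w0 n - exp 1) - (\<rho> n - exp 1))) +
        (1 / real n - 1 / real (Suc n)) = \<beta> (Suc n) - 1 / real (Suc n)) sequentially"
      using eventually_ge_at_top[of 1]
    proof eventually_elim
      case (elim n)
      have "\<rho> n > 0" using code_count_1_pos[of n] code_count_1_pos[of "Suc n"] elim by (simp add: \<rho>_def)
      then have "1 / real n * (1 / \<rho> n * (real n * \<rho> n * \<beta> (Suc n) - \<rho> n)) = \<beta> (Suc n) - 1 / real n"
        using elim by (simp add: field_simps)
      then show ?case by (simp add: q_def)
    qed
    ultimately show "(\<lambda>n. \<beta> (Suc n) - 1 / real (Suc n)) \<in> O(\<lambda>n. 1 / (real (Suc n))\<^sup>2)"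
      using landau_o.big.in_cong by fastforce
  qed
  \<comment> \<open>Splits \<open>\<beta> n * w2 n\<close> - e/(2n) into \<open>\<beta>\<close>
    times the error of \<open>w2\<close>, plus e/2 times the error of
    \<open>\<beta>\<close>.\<close>
  have "(\<lambda>n. \<beta> n * (w2 n - exp 1 / 2)) \<in> O(\<lambda>n. 1 / real n * (1 / real n))"
    using \<beta>1 weight_2_asymp unfolding w2_def by (rule landau_o.big.mult)
  then have "(\<lambda>n. \<beta> n * (w2 n - exp 1 / 2)) \<in> O(\<lambda>n. 1 / (real n)\<^sup>2)"
    by (simp add: power2_eq_square)
  moreover have "(\<lambda>n. exp 1 / 2 * (\<beta> n - 1 / real n)) \<in> O(\<lambda>n. 1 / (real n)\<^sup>2)"
    using \<beta>2 by simp
  ultimately have "(\<lambda>n. (w1 n - exp 1 * (1 - 1 / real n)) + \<beta> n * (w2 n - exp 1 / 2) +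
      exp 1 / 2 * (\<beta> n - 1 / real n) + r n) \<in> O(\<lambda>n. 1 / (real n)\<^sup>2)"
    using weight_1_asymp r unfolding w1_def by (intro sum_in_bigo(1))
  then show ?thesis
    unfolding \<rho>_def[symmetric] r_def by (simp add: algebra_simps add_divide_distrib diff_divide_distrib)
qed

section \<open>The one-source count with its constant\<close>

text \<open>In the consecutive ratio \<open>sf\<close> accounts for n! and the exponential for e,
  leaving only 1 - 1/(2n) to be absorbed by the square root.\<close>

lemma one_source_asymp:
  "\<exists>C > 0. (\<lambda>n. real (D_star n) * sqrt (real n) / (exp (real n - 1) * real (sf (n - 1))) / C - 1)
     \<in> O(\<lambda>n. 1 / real n)"
proof -
  define b where "b n = code_count n 1 * sqrt (real n) / (exp (real n - 1) * real (sf (n - 1)))" for n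
  define \<rho> where "\<rho> n = code_count (Suc n) 1 / (fact n * code_count n 1)" for n
  define s where "s n = sqrt ((real n + 1) / real n)" for n
  have sf_pos: "real (sf n) > 0" for n by (simp add: sf_def prod_pos)
  have pos: "b n > 0" if "n \<ge> 1" for n
    using code_count_1_pos[OF that] sf_pos that by (simp add: b_def)
  have "(\<lambda>n. (\<rho> n - exp 1 * (1 - 1 / (2 * real n))) * (s n / exp 1)) \<in> O(\<lambda>n. 1 / (real n)\<^sup>2)"
  proof (rule bigo_mult_const)
    have "(\<lambda>n. s n - 1) \<in> O(\<lambda>n. 1 / real n)" unfolding s_def by real_asymp
    then have "(\<lambda>n. 1 / exp 1 * (s n - 1)) \<in> O(\<lambda>n. 1 / real n)"
      by (subst landau_o.big.cmult_in_iff) simp_all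
    then show "(\<lambda>n. s n / exp 1 - 1 / exp 1) \<in> O(\<lambda>n. 1 / real n)"
      by (simp add: diff_divide_distrib)
  qed (use one_source_ratio in \<open>simp add: \<rho>_def\<close>)
  \<comment> \<open>Since \<open>s n\<close> = 1 + 1/(2n) + O(1/n^2), the first-order terms cancel;
    this is what fixes the exponent 1/2.\<close>
  moreover have "(\<lambda>n. (1 - 1 / (2 * real n)) * s n - 1) \<in> O(\<lambda>n. 1 / (real n)\<^sup>2)"
    unfolding s_def by real_asymp
  ultimately have "(\<lambda>n. (\<rho> n - exp 1 * (1 - 1 / (2 * real n))) * (s n / exp 1) +
      ((1 - 1 / (2 * real n)) * s n - 1)) \<in> O(\<lambda>n. 1 / (real n)\<^sup>2)"
    by (rule sum_in_bigo)
  moreover have "eventually (\<lambda>n. (\<rho> n - exp 1 * (1 - 1 / (2 * real n))) * (s n / exp 1) +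
      ((1 - 1 / (2 * real n)) * s n - 1) = b (Suc n) / b n - 1) sequentially"
    using eventually_ge_at_top[of 1]
  proof eventually_elim
    case (elim n)
    then obtain m where m: "n = Suc m" by (cases n) auto
    have "real (sf n) = fact n * real (sf (n - 1))" unfolding m sf_def by (simp add: algebra_simps)
    moreover have "exp (real (Suc n) - 1) = exp 1 * exp (real n - 1)"
      by (simp flip: exp_add)
    moreover have "sqrt (real (Suc n)) = s n * sqrt (real n)"
      using elim by (simp add: s_def real_sqrt_divide add.commute)
    moreover have "b (Suc n) = code_count (Suc n) 1 * sqrt (real (Suc n)) / (exp (real (Suc n) - 1) * real (sf n))"
      by (simp add: b_def)
    ultimately have "b (Suc n) = code_count (Suc n) 1 * (s n * sqrt (real n)) /
        (exp 1 * exp (real n - 1) * (fact n * real (sf (n - 1))))"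
      by (simp only:)
    then have "b (Suc n) / b n = \<rho> n * (s n / exp 1)"
      unfolding b_def[of n] \<rho>_def using elim sf_pos[of "n - 1"] code_count_1_pos[OF elim]
      by (simp add: field_simps)
    then show ?case by (simp add: algebra_simps)
  qed
  ultimately have "(\<lambda>n. b (Suc n) / b n - 1) \<in> O(\<lambda>n. 1 / (real n)\<^sup>2)"
    using landau_o.big.in_cong by fastforce
  moreover have "eventually (\<lambda>n. b n > 0) sequentially"
    using eventually_ge_at_top[of 1] by eventually_elim (rule pos)
  ultimately show ?thesis
    using ratio_asymptotics[of b] by (simp add: b_def code_count_1_eq_D_star[symmetric])
qed

theorem theorem5p5:
  shows "\<exists>C::real. C > 0 \<and>
    (\<exists>\<epsilon> \<delta> :: nat \<Rightarrow> real.
       \<epsilon> \<in> O(\<lambda>n. 1 / real n) \<and> \<delta> \<in> O(\<lambda>n. 1 / real n) \<and>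
       (\<forall>\<^sub>F n in sequentially.
          real (D n) = (1 + \<epsilon> n) * real (D_star n) \<and>
          (1 + \<epsilon> n) * real (D_star n) =
            C / sqrt (real n) * exp (real n - 1) * real (sf (n - 1)) * (1 + \<delta> n)))"
proof -
  let ?b = "\<lambda>n. real (D_star n) * sqrt (real n) / (exp (real n - 1) * real (sf (n - 1)))"
  obtain C where C: "C > 0" "(\<lambda>n. ?b n / C - 1) \<in> O(\<lambda>n. 1 / real n)"
    using one_source_asymp by blast
  \<comment> \<open>Exact relative error: every nonempty graph has a source, so \<open>D n\<close>
    is the one-source count plus \<open>tail_count 2 n\<close>.\<close>
  define \<epsilon> where "\<epsilon> n = tail_count 2 n / code_count n 1" for n
  define \<eta> where "\<eta> n = ?b n / C - 1" for n
  \<comment> \<open>Chosen so that 1 + \<open>\<delta> n\<close> is the product of 1 +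
    \<open>\<epsilon> n\<close> and 1 + \<open>\<eta> n\<close>.\<close>
  define \<delta> where "\<delta> n = \<epsilon> n + \<eta> n + \<epsilon> n * \<eta> n" for n
  have \<epsilon>: "\<epsilon> \<in> O(\<lambda>n. 1 / real n)" unfolding \<epsilon>_def by (rule tail_count_2_ratio)
  have \<eta>: "\<eta> \<in> O(\<lambda>n. 1 / real n)" unfolding \<eta>_def by (rule C(2))
  have "(\<lambda>n. \<epsilon> n * \<eta> n) \<in> O(\<lambda>n. 1 / real n)"
    by (rule bigo_mult_const[where c = 0]) (use \<epsilon> \<eta> in simp_all)
  then have "\<delta> \<in> O(\<lambda>n. 1 / real n)"
    using \<epsilon> \<eta> unfolding \<delta>_def by (intro sum_in_bigo(1))
  moreover have "eventually (\<lambda>n. real (D n) = (1 + \<epsilon> n) * real (D_star n) \<and>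
      (1 + \<epsilon> n) * real (D_star n) =
        C / sqrt (real n) * exp (real n - 1) * real (sf (n - 1)) * (1 + \<delta> n)) sequentially"
    using eventually_ge_at_top[of 1]
  proof eventually_elim
    case (elim n)
    have "real (D n) = (1 + \<epsilon> n) * real (D_star n)"
      using tail_count_0_eq[OF elim] code_count_1_pos[OF elim]
      by (simp add: \<epsilon>_def tail_count_0_eq_D field_simps flip: code_count_1_eq_D_star)
    moreover have "real (D_star n) =
        C / sqrt (real n) * exp (real n - 1) * real (sf (n - 1)) * (1 + \<eta> n)"
    proof -
      have "real (sf (n - 1)) > 0" by (simp add: sf_def prod_pos)
      then show ?thesis using C(1) elim by (simp add: \<eta>_def field_simps)
    qed
    moreover have "1 + \<delta> n = (1 + \<epsilon> n) * (1 + \<eta> n)" by (simp add: \<delta>_def algebra_simps)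
    ultimately show ?case by (simp add: mult_ac)
  qed
  ultimately show ?thesis using C(1) \<epsilon> by blast
qed

end
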